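(* Let $E\subset L_1(0,\infty)$ be a fully symmetric Banach space on the semi-axis $(0,\infty)$. For every given $0\le x\in E$, there exists a singular fully symmetric linear functional $\varphi_{sing}$ on $E$ such that $$\varphi_{sing}(x)=\lim_{m\to\infty}\frac1m\|\sigma_m(\mu(x))\chi_{(0,1)}\|_E.$$
   Context: For a measurable function $x$ on $(0,\infty)$, $\mu(t,x)=\inf\{s\ge0:\ |\{|x|>s\}|\le t\}$ (Lebesgue measure) is its decreasing rearrangement; $y\prec\prec x$ means $\int_0^t\mu(s,y)ds\le\int_0^t\mu(s,x)ds$ for all $t\ge0$. A fully symmetric Banach space $E$ on $(0,\infty)$ is a Banach space of (real-valued) functions $E\subset(L_1+L_\infty)(0,\infty)$ such that $x\in E$, $y\in L_1+L_\infty$ and $y\prec\prec x$ imply $y\in E$ and $\|y\|_E\le\|x\|_E$. The dilation operator is $(\sigma_mx)(t)=x(t/m)$, $t>0$. A linear functional $\varphi$ on $E$ is fully symmetric if $\varphi(y)\le\varphi(x)$ for all $0\le x,y\in E$ with $y\prec\prec x$, and singular if $\varphi=0$ on $(L_1\cap L_\infty)(0,\infty)$. *)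

theory Defs
  imports "HOL-Analysis.Analysis"
begin

text \<open>
  Functions on the semi-axis are represented by total functions on the reals whose values outside
  the open half-line are irrelevant. A function space is a set of such representatives, not of
  classes modulo null sets; equality and order are understood almost everywhere.
\<close>

abbreviation halfline :: "real measure" where
  "halfline \<equiv> lebesgue_on {0<..}"

definition L1 :: "(real \<Rightarrow> real) set" where
  "L1 = {f. integrable halfline f}"

definition Linf :: "(real \<Rightarrow> real) set" where
  "Linf = {f \<in> borel_measurable halfline. \<exists>C. AE t in halfline. \<bar>f t\<bar> \<le> C}"

definition L1_plus_Linf :: "(real \<Rightarrow> real) set" where
  "L1_plus_Linf = {f. \<exists>g\<in>L1. \<exists>h\<in>Linf. \<forall>t>0. f t = g t + h t}"

text \<open>
  For \<open>x\<close> in \<open>L1_plus_Linf\<close> the infimum below is over a nonempty set whenever \<open>t > 0\<close>. At \<open>t = 0\<close>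
  the set is empty if \<open>x\<close> is unbounded, and the value is then unspecified; no notion below depends
  on it.
\<close>

definition rearr :: "(real \<Rightarrow> real) \<Rightarrow> real \<Rightarrow> real" where
  "rearr x t = Inf {s. 0 \<le> s \<and> emeasure halfline {u. 0 < u \<and> \<bar>x u\<bar> > s} \<le> ennreal t}"

definition submajorized :: "(real \<Rightarrow> real) \<Rightarrow> (real \<Rightarrow> real) \<Rightarrow> bool"  (infix "\<prec>\<prec>" 50) where
  "y \<prec>\<prec> x \<longleftrightarrow> (\<forall>t\<ge>0. (\<integral>\<^sup>+ s\<in>{0<..<t}. ennreal (rearr y s) \<partial>lborel)
                     \<le> (\<integral>\<^sup>+ s\<in>{0<..<t}. ennreal (rearr x s) \<partial>lborel))"

definition dilation :: "real \<Rightarrow> (real \<Rightarrow> real) \<Rightarrow> real \<Rightarrow> real" where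
  "dilation m x t = x (t / m)"

text \<open>
  The last condition, applied to functions that agree almost everywhere, makes membership in \<open>E\<close>
  and the norm \<open>N\<close> well defined on classes.
\<close>

definition fully_symmetric_Banach_space ::
    "(real \<Rightarrow> real) set \<Rightarrow> ((real \<Rightarrow> real) \<Rightarrow> real) \<Rightarrow> bool" where
  "fully_symmetric_Banach_space E N \<longleftrightarrow>
     E \<subseteq> L1_plus_Linf \<and>
     (\<lambda>t. 0) \<in> E \<and>
     (\<forall>x\<in>E. \<forall>y\<in>E. (\<lambda>t. x t + y t) \<in> E \<and> N (\<lambda>t. x t + y t) \<le> N x + N y) \<and>
     (\<forall>c. \<forall>x\<in>E. (\<lambda>t. c * x t) \<in> E \<and> N (\<lambda>t. c * x t) = \<bar>c\<bar> * N x) \<and>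
     (\<forall>x\<in>E. 0 \<le> N x \<and> (N x = 0 \<longleftrightarrow> (AE t in halfline. x t = 0))) \<and>
     (\<forall>X. (\<forall>n. X n \<in> E) \<and>
          (\<forall>e>0. \<exists>M. \<forall>m\<ge>M. \<forall>n\<ge>M. N (\<lambda>t. X m t - X n t) < e) \<longrightarrow>
          (\<exists>x\<in>E. (\<lambda>n::nat. N (\<lambda>t. X n t - x t)) \<longlonglongrightarrow> 0)) \<and>
     (\<forall>x\<in>E. \<forall>y\<in>L1_plus_Linf. y \<prec>\<prec> x \<longrightarrow> y \<in> E \<and> N y \<le> N x)"

definition linear_functional ::
    "(real \<Rightarrow> real) set \<Rightarrow> ((real \<Rightarrow> real) \<Rightarrow> real) \<Rightarrow> bool" where
  "linear_functional E \<phi> \<longleftrightarrow>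
     (\<forall>x\<in>E. \<forall>y\<in>E. \<phi> (\<lambda>t. x t + y t) = \<phi> x + \<phi> y) \<and>
     (\<forall>c. \<forall>x\<in>E. \<phi> (\<lambda>t. c * x t) = c * \<phi> x) \<and>
     (\<forall>x\<in>E. \<forall>y\<in>E. (AE t in halfline. x t = y t) \<longrightarrow> \<phi> x = \<phi> y)"

definition fully_symmetric_functional ::
    "(real \<Rightarrow> real) set \<Rightarrow> ((real \<Rightarrow> real) \<Rightarrow> real) \<Rightarrow> bool" where
  "fully_symmetric_functional E \<phi> \<longleftrightarrow>
     (\<forall>x\<in>E. \<forall>y\<in>E. (AE t in halfline. 0 \<le> x t) \<longrightarrow> (AE t in halfline. 0 \<le> y t) \<longrightarrow>
        y \<prec>\<prec> x \<longrightarrow> \<phi> y \<le> \<phi> x)"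

text \<open>
  A nonzero fully symmetric space contains \<open>L1 \<inter> Linf\<close>; the intersection with \<open>E\<close> only matters for
  the zero space.
\<close>

definition singular_functional ::
    "(real \<Rightarrow> real) set \<Rightarrow> ((real \<Rightarrow> real) \<Rightarrow> real) \<Rightarrow> bool" where
  "singular_functional E \<phi> \<longleftrightarrow> (\<forall>x \<in> E \<inter> (L1 \<inter> Linf). \<phi> x = 0)"

end

theory Submission
  imports Defs
begin

text \<open>
  Write \<open>K y t\<close> for the integral of the decreasing rearrangement of \<open>y\<close> over \<open>(0, t)\<close>
  (\<open>Kfun\<close> with values in \<open>ennreal\<close>, \<open>head\<close> with real values), so that
  submajorization is the pointwise order of the functions \<open>K y\<close>. By Peetre's formula,
  \<open>K y t\<close> is the minimum over \<open>s \<ge> 0\<close> of \<open>\<integral> (\<bar>y\<bar> - s)\<^sub>+ + t * s\<close>, which gives for nonnegative \<open>a\<close> and \<open>b\<close>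
  the two estimates

    \<open>K a (t / 2) + K b (t / 2) \<le> K (a + b) t \<le> K a t + K b t\<close>.

  Hence a linear functional \<open>L\<close> on a space of functions of \<open>t\<close> that is monotone and satisfies
  \<open>L (K a) = L (\<lambda>t. K a (t / 2))\<close> makes \<open>a \<mapsto> L (K a)\<close> additive on the positive cone of \<open>E\<close>. Its
  linear extension \<open>y \<mapsto> L (K y\<^sup>+) - L (K y\<^sup>-)\<close> is then fully symmetric, because it depends
  on a nonnegative \<open>y\<close> only through \<open>K y\<close> and does so monotonically.

  It remains to find \<open>L\<close> with the right value at \<open>K x\<close>. The function
  \<open>(1 / m) \<sigma>\<^sub>m(\<mu>(y)) \<chi>\<^sub>(\<^sub>0\<^sub>,\<^sub>1\<^sub>)\<close>, called \<open>compressed m y\<close>, satisfies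
  \<open>K (compressed m y) t = K y (min t 1 / m)\<close>. Its norm is therefore decreasing in \<open>m\<close>, and the limit
  \<open>limit_norm y\<close> exists; it is \<open>0\<close> for bounded \<open>y\<close>, whose compressions have norm \<open>O(1 / m)\<close>.
  Let \<open>mean_norm F\<close> be the infimum of \<open>N h\<close> over all \<open>h\<close> in \<open>E\<close> for which \<open>K h\<close>
  eventually dominates on \<open>(0, 1]\<close> the averages of \<open>F t, F (t / 2), \<dots>, F (t / 2 ^ (n - 1))\<close>. This
  functional is sublinear, nonpositive at every nonpositive \<open>F\<close>, and nonpositive at
  \<open>K y - (\<lambda>t. K y (t / 2))\<close> because the averages telescope. So every linear functional below it has
  the two properties required of \<open>L\<close>. Comparing the averages of \<open>K y\<close> with \<open>K y\<close> at small dyadic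
  dilations gives \<open>mean_norm (K y) = limit_norm y\<close> (lemma \<open>mean_norm_head\<close>). The Hahn--Banach
  theorem \<open>hahn_banach_attained\<close> provides \<open>L \<le> mean_norm\<close> with equality at \<open>K x\<close>; singularity follows
  since \<open>L (K a)\<close> lies between \<open>0\<close> and \<open>limit_norm a = 0\<close> for bounded nonnegative \<open>a\<close>.
\<close>

section \<open>Distribution functions\<close>

lemma sigma_finite_lebesgue: "sigma_finite_measure (lebesgue :: real measure)"
proof
  have "emeasure lebesgue {- real n..real n} \<noteq> \<infinity>" for n
    by simp
  moreover have "(\<Union>n. {- real n..real n}) = (UNIV :: real set)"
    by (auto, meson abs_le_D1 abs_le_D2 minus_le_iff real_arch_simple)
  ultimately show "\<exists>A. countable A \<and> A \<subseteq> sets (lebesgue :: real measure) \<and> \<Union> A = space lebesgue \<and>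
      (\<forall>a\<in>A. emeasure lebesgue a \<noteq> \<infinity>)"
    by (intro exI[of _ "range (\<lambda>n. {- real n..real n})"]) auto
qed

interpretation halfline: sigma_finite_measure halfline
  by (intro sigma_finite_measure_restrict_space sigma_finite_lebesgue) simp

text \<open>
Fubini for the region between the level \<open>s\<close> and the graph of \<open>f\<close>. With \<open>s = 0\<close> this is the usual
layer cake formula; general \<open>s\<close> is what Peetre's formula uses.
\<close>

lemma layer_cake:
  assumes "sigma_finite_measure M" and [measurable]: "f \<in> borel_measurable M"
  shows "(\<integral>\<^sup>+ u. ennreal (f u - s) \<partial>M) = (\<integral>\<^sup>+ r\<in>{s..}. emeasure M {u \<in> space M. r < f u} \<partial>lborel)"
proof -
  interpret sigma_finite_measure M by fact
  interpret pair_sigma_finite M lborel ..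
  define g :: "'a \<Rightarrow> real \<Rightarrow> ennreal" where "g u r = (if s \<le> r \<and> r < f u then 1 else 0)" for u r
  have meas: "case_prod g \<in> borel_measurable (M \<Otimes>\<^sub>M lborel)"
    unfolding g_def by measurable
  have "ennreal (f u - s) = (\<integral>\<^sup>+ r. g u r \<partial>lborel)" for u
  proof -
    have "(\<integral>\<^sup>+ r. g u r \<partial>lborel) = (\<integral>\<^sup>+ r. indicator {s..<f u} r \<partial>lborel)"
      by (intro nn_integral_cong) (auto simp: g_def)
    then show ?thesis
      by (cases "s \<le> f u") (auto simp: ennreal_neg)
  qed
  then have "(\<integral>\<^sup>+ u. ennreal (f u - s) \<partial>M) = (\<integral>\<^sup>+ u. \<integral>\<^sup>+ r. g u r \<partial>lborel \<partial>M)"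
    by simp
  also have "\<dots> = (\<integral>\<^sup>+ r. \<integral>\<^sup>+ u. g u r \<partial>M \<partial>lborel)"
    by (rule Fubini'[OF meas, symmetric])
  also have "\<dots> = (\<integral>\<^sup>+ r\<in>{s..}. emeasure M {u \<in> space M. r < f u} \<partial>lborel)"
  proof (intro nn_integral_cong)
    fix r
    have "(\<integral>\<^sup>+ u. g u r \<partial>M) = (\<integral>\<^sup>+ u. indicator {s..} r * indicator {u \<in> space M. r < f u} u \<partial>M)"
      by (intro nn_integral_cong) (auto simp: g_def)
    also have "\<dots> = indicator {s..} r * emeasure M {u \<in> space M. r < f u}"
      by (subst nn_integral_cmult) auto
    finally show "(\<integral>\<^sup>+ u. g u r \<partial>M) = emeasure M {u \<in> space M. r < f u} * indicator {s..} r"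
      by (simp add: mult.commute)
  qed
  finally show ?thesis .
qed

definition distfun :: "(real \<Rightarrow> real) \<Rightarrow> real \<Rightarrow> ennreal" where
  "distfun y s = emeasure halfline {u. 0 < u \<and> s < \<bar>y u\<bar>}"

text \<open>
Peetre's K-functional of the couple \<open>(L\<^sub>1, L\<^sub>\<infinity>)\<close>. It is the integral of the rearrangement over \<open>(0, t)\<close>
(lemma \<open>integral_rearr\<close>), written through the distribution function because \<open>layer_cake\<close> then
compares it with \<open>\<integral> (\<bar>y\<bar> - s)\<^sub>+\<close> level by level.
\<close>

definition Kfun :: "(real \<Rightarrow> real) \<Rightarrow> real \<Rightarrow> ennreal" where
  "Kfun y t = (\<integral>\<^sup>+ s\<in>{0..}. min (distfun y s) (ennreal t) \<partial>lborel)"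

text \<open>
The positive part in \<open>(\<bar>y\<bar> - s)\<^sub>+\<close> is left to \<open>ennreal\<close>, which sends negative numbers to \<open>0\<close>.
\<close>

definition excess :: "(real \<Rightarrow> real) \<Rightarrow> real \<Rightarrow> ennreal" where
  "excess y s = (\<integral>\<^sup>+ u. ennreal (\<bar>y u\<bar> - s) \<partial>halfline)"

lemma L1_measurable [measurable_dest]: "y \<in> L1 \<Longrightarrow> y \<in> borel_measurable halfline"
  by (auto simp: L1_def)

lemma superlevel_eq:
  fixes y :: "real \<Rightarrow> real"
  shows "{u. 0 < u \<and> s < \<bar>y u\<bar>} = {u \<in> space halfline. s < \<bar>y u\<bar>}"
  by auto

lemma superlevel_sets:
  fixes y :: "real \<Rightarrow> real"
  assumes [measurable]: "y \<in> borel_measurable halfline"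
  shows "{u. 0 < u \<and> s < \<bar>y u\<bar>} \<in> sets halfline"
  unfolding superlevel_eq by measurable

lemma distfun_measurable [measurable]:
  assumes [measurable]: "y \<in> borel_measurable halfline"
  shows "distfun y \<in> borel_measurable lborel"
  unfolding distfun_def superlevel_eq
  by (rule halfline.measurable_emeasure) measurable

lemma distfun_antimono:
  assumes [measurable]: "y \<in> borel_measurable halfline" and "r \<le> s"
  shows "distfun y s \<le> distfun y r"
  unfolding distfun_def using assms(2) by (intro emeasure_mono superlevel_sets) auto

lemma distfun_cong_AE:
  assumes "y \<in> borel_measurable halfline" "z \<in> borel_measurable halfline"
    and "AE u in halfline. y u = z u"
  shows "distfun y = distfun z"
proof
  fix s
  note [measurable] = assms(1,2)
  show "distfun y s = distfun z s"
    unfolding distfun_def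
    using assms(3) by (intro emeasure_eq_AE superlevel_sets) auto
qed

lemma excess_layer_cake:
  assumes [measurable]: "y \<in> borel_measurable halfline"
  shows "excess y s = (\<integral>\<^sup>+ r\<in>{s..}. distfun y r \<partial>lborel)"
  unfolding excess_def distfun_def superlevel_eq
  by (rule layer_cake) (use halfline.sigma_finite_measure_axioms in measurable)

lemma excess_finite:
  assumes "y \<in> L1" "s \<ge> 0"
  shows "excess y s < \<infinity>"
proof -
  have "excess y s \<le> (\<integral>\<^sup>+ u. ennreal (norm (y u)) \<partial>halfline)"
    unfolding excess_def using assms(2) by (intro nn_integral_mono ennreal_leI) auto
  also have "\<dots> < \<infinity>"
    using assms(1) by (simp add: L1_def integrable_iff_bounded)
  finally show ?thesis .
qed

text \<open>
The sets where \<open>\<bar>y\<bar>\<close> exceeds \<open>r + 1 / (n + 1)\<close> increase to the set where it exceeds \<open>r\<close>.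
\<close>

lemma distfun_right_continuous:
  assumes [measurable]: "y \<in> borel_measurable halfline" and "c < distfun y r"
  shows "\<exists>s>r. c < distfun y s"
proof -
  have "incseq (\<lambda>n. {u \<in> space halfline. r + 1 / real (Suc n) < \<bar>y u\<bar>})"
  proof (rule incseq_SucI, rule Collect_mono, rule impI)
    fix n u
    assume "u \<in> space halfline \<and> r + 1 / real (Suc n) < \<bar>y u\<bar>"
    moreover have "1 / real (Suc (Suc n)) \<le> 1 / real (Suc n)"
      by (intro divide_left_mono) auto
    ultimately show "u \<in> space halfline \<and> r + 1 / real (Suc (Suc n)) < \<bar>y u\<bar>"
      by linarith
  qed
  then have "(SUP n. emeasure halfline {u \<in> space halfline. r + 1 / real (Suc n) < \<bar>y u\<bar>}) =
     emeasure halfline (\<Union>n. {u \<in> space halfline. r + 1 / real (Suc n) < \<bar>y u\<bar>})"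
    by (intro SUP_emeasure_incseq) (auto simp flip: superlevel_eq intro!: superlevel_sets)
  also have "(\<Union>n. {u \<in> space halfline. r + 1 / real (Suc n) < \<bar>y u\<bar>}) =
      {u \<in> space halfline. r < \<bar>y u\<bar>}"
  proof (intro equalityI subsetI)
    fix u assume u: "u \<in> {u \<in> space halfline. r < \<bar>y u\<bar>}"
    then obtain n where "inverse (real (Suc n)) < \<bar>y u\<bar> - r"
      using reals_Archimedean[of "\<bar>y u\<bar> - r"] by auto
    then show "u \<in> (\<Union>n. {u \<in> space halfline. r + 1 / real (Suc n) < \<bar>y u\<bar>})"
      using u by (auto simp: field_simps inverse_eq_divide intro!: exI[of _ n])
  next
    fix u assume "u \<in> (\<Union>n. {u \<in> space halfline. r + 1 / real (Suc n) < \<bar>y u\<bar>})"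
    then obtain n where "u \<in> space halfline" "r + 1 / real (Suc n) < \<bar>y u\<bar>"
      by auto
    moreover have "r < r + 1 / real (Suc n)" by simp
    ultimately show "u \<in> {u \<in> space halfline. r < \<bar>y u\<bar>}"
      using order_less_trans by blast
  qed
  finally have "c < (SUP n. distfun y (r + 1 / real (Suc n)))"
    using assms(2) by (simp only: distfun_def superlevel_eq)
  then obtain n where "c < distfun y (r + 1 / real (Suc n))"
    by (auto simp: less_SUP_iff)
  then show ?thesis
    by (intro exI[of _ "r + 1 / real (Suc n)"]) auto
qed

text \<open>
Chebyshev's inequality. It makes the infimum in the definition of \<open>rearr\<close> range over a nonempty set.
\<close>

lemma distfun_vanishes:
  assumes y: "y \<in> L1" and t: "t > 0"
  shows "\<exists>s\<ge>0. distfun y s \<le> ennreal t"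
proof -
  note [measurable] = L1_measurable[OF y]
  have int: "integrable halfline y"
    using y by (simp add: L1_def)
  define I where "I = (\<integral>u. \<bar>y u\<bar> \<partial>halfline)"
  have I: "I \<ge> 0" unfolding I_def by simp
  have bound: "(\<integral>\<^sup>+ u. ennreal \<bar>y u\<bar> \<partial>halfline) = ennreal I"
    unfolding I_def using int by (intro nn_integral_eq_integral) auto
  define s where "s = (I + 1) / t"
  have s: "s > 0" using I t by (simp add: s_def)
  have "ennreal s * distfun y s = (\<integral>\<^sup>+ u. ennreal s * indicator {u \<in> space halfline. s < \<bar>y u\<bar>} u \<partial>halfline)"
    unfolding distfun_def superlevel_eq by (subst nn_integral_cmult_indicator) (auto simp flip: superlevel_eq intro: superlevel_sets)
  also have "\<dots> \<le> (\<integral>\<^sup>+ u. ennreal \<bar>y u\<bar> \<partial>halfline)"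
    by (intro nn_integral_mono) (auto simp: indicator_def intro!: ennreal_leI)
  also have "\<dots> \<le> ennreal (s * t)"
    unfolding bound using I t by (intro ennreal_leI) (simp add: s_def)
  finally have "ennreal s * distfun y s \<le> ennreal s * ennreal t"
    using s t by (simp add: ennreal_mult)
  then have "distfun y s \<le> ennreal t"
    using s by (subst (asm) ennreal_mult_le_mult_iff) auto
  then show ?thesis
    using s by (intro exI[of _ s]) auto
qed

text \<open>
The rearrangement is the generalized inverse of the distribution function. The backward direction
rests on right continuity: otherwise the infimum could equal \<open>r\<close> itself.
\<close>

lemma less_rearr_iff:
  assumes y: "y \<in> L1" and t: "t > 0" and r: "r \<ge> 0"
  shows "r < rearr y t \<longleftrightarrow> ennreal t < distfun y r"
proof -
  define S where "S = {s. 0 \<le> s \<and> distfun y s \<le> ennreal t}"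
  have rearr: "rearr y t = Inf S"
    by (simp add: rearr_def S_def distfun_def)
  have S: "S \<noteq> {}" "bdd_below S"
    using distfun_vanishes[OF y t] by (auto simp: S_def intro!: bdd_belowI[of _ 0])
  show ?thesis
  proof
    assume "r < rearr y t"
    then have "r \<notin> S"
      using S(2) cInf_lower[of r S] unfolding rearr by force
    then show "ennreal t < distfun y r"
      using r by (auto simp: S_def)
  next
    assume "ennreal t < distfun y r"
    then obtain s where s: "s > r" "ennreal t < distfun y s"
      using distfun_right_continuous[OF L1_measurable[OF y]] by blast
    have "s \<le> v" if "v \<in> S" for v
    proof (rule ccontr)
      assume "\<not> s \<le> v"
      then have "distfun y s \<le> distfun y v"
        by (intro distfun_antimono L1_measurable y) auto
      then show False
        using s(2) that by (auto simp: S_def)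
    qed
    then have "s \<le> Inf S"
      using S(1) by (intro cInf_greatest) auto
    then show "r < rearr y t"
      using s(1) by (simp add: rearr)
  qed
qed

lemma rearr_nonneg:
  assumes y: "y \<in> L1" and t: "t > 0"
  shows "rearr y t \<ge> 0"
  unfolding rearr_def using distfun_vanishes[OF y t]
  by (intro cInf_greatest) (auto simp: distfun_def)

section \<open>Peetre's formula and its consequences\<close>

lemma Kfun_le:
  assumes [measurable]: "y \<in> borel_measurable halfline" and s: "s \<ge> 0" and t: "t \<ge> 0"
  shows "Kfun y t \<le> excess y s + ennreal (t * s)"
proof -
  have "Kfun y t \<le> (\<integral>\<^sup>+ r. distfun y r * indicator {s..} r + ennreal t * indicator {0..<s} r \<partial>lborel)"
    unfolding Kfun_def by (intro nn_integral_mono) (auto simp: indicator_def)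
  also have "\<dots> = excess y s + ennreal t * ennreal s"
    using s by (subst nn_integral_add) (auto simp: excess_layer_cake nn_integral_cmult)
  finally show ?thesis
    using s t by (simp add: ennreal_mult)
qed

text \<open>
The minimizing level is \<open>\<mu>(t)\<close>: the distribution function exceeds \<open>t\<close> exactly below it, so the
minimum in the definition of \<open>Kfun\<close> equals \<open>t\<close> there and the distribution function above.
\<close>

lemma Kfun_attained:
  assumes y: "y \<in> L1" and t: "t > 0"
  obtains s where "s \<ge> 0" "Kfun y t = excess y s + ennreal (t * s)"
proof -
  note [measurable] = L1_measurable[OF y]
  define s where "s = rearr y t"
  have s: "s \<ge> 0" using rearr_nonneg[OF y t] by (simp add: s_def)
  have "Kfun y t = (\<integral>\<^sup>+ r. distfun y r * indicator {s..} r + ennreal t * indicator {0..<s} r \<partial>lborel)"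
    unfolding Kfun_def
  proof (intro nn_integral_cong)
    fix r :: real
    show "min (distfun y r) (ennreal t) * indicator {0..} r =
        distfun y r * indicator {s..} r + ennreal t * indicator {0..<s} r"
      using less_rearr_iff[OF y t, of r] s by (auto simp: indicator_def s_def min_def not_less)
  qed
  also have "\<dots> = excess y s + ennreal t * ennreal s"
    using s by (subst nn_integral_add) (auto simp: excess_layer_cake nn_integral_cmult)
  finally show thesis
    using s t by (intro that[of s]) (auto simp: ennreal_mult)
qed

lemma Kfun_finite:
  assumes "y \<in> L1" "t \<ge> 0"
  shows "Kfun y t < \<infinity>"
  using Kfun_le[OF L1_measurable[OF assms(1)], of 0 t] excess_finite[OF assms(1), of 0] assms
  by (auto simp: order_le_less_trans)

lemma Kfun_mono: "s \<le> t \<Longrightarrow> Kfun y s \<le> Kfun y t"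
  unfolding Kfun_def by (intro nn_integral_mono mult_right_mono min.mono ennreal_leI) auto

text \<open>
If \<open>s\<close> and \<open>r\<close> are optimal for the summands, the level \<open>s + r\<close> is admissible for the sum.
\<close>

lemma Kfun_subadditive:
  assumes y: "y \<in> L1" and z: "z \<in> L1" and t: "t > 0"
  shows "Kfun (\<lambda>u. y u + z u) t \<le> Kfun y t + Kfun z t"
proof -
  note [measurable] = L1_measurable[OF y] L1_measurable[OF z]
  obtain s where s: "s \<ge> 0" "Kfun y t = excess y s + ennreal (t * s)"
    using Kfun_attained[OF y t] by blast
  obtain r where r: "r \<ge> 0" "Kfun z t = excess z r + ennreal (t * r)"
    using Kfun_attained[OF z t] by blast
  have "excess (\<lambda>u. y u + z u) (s + r) \<le> (\<integral>\<^sup>+ u. ennreal (\<bar>y u\<bar> - s) + ennreal (\<bar>z u\<bar> - r) \<partial>halfline)"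
    unfolding excess_def
  proof (intro nn_integral_mono)
    fix u
    have "ennreal (\<bar>y u + z u\<bar> - (s + r)) \<le> ennreal (max 0 (\<bar>y u\<bar> - s) + max 0 (\<bar>z u\<bar> - r))"
      by (intro ennreal_leI) auto
    then show "ennreal (\<bar>y u + z u\<bar> - (s + r)) \<le> ennreal (\<bar>y u\<bar> - s) + ennreal (\<bar>z u\<bar> - r)"
      by (simp add: max_def ennreal_neg split: if_splits)
  qed
  also have "\<dots> = excess y s + excess z r"
    unfolding excess_def by (subst nn_integral_add) auto
  finally have ex: "excess (\<lambda>u. y u + z u) (s + r) \<le> excess y s + excess z r" .
  have "Kfun (\<lambda>u. y u + z u) t \<le> excess (\<lambda>u. y u + z u) (s + r) + ennreal (t * (s + r))"
    using s r t by (intro Kfun_le) auto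
  also have "\<dots> \<le> excess y s + excess z r + ennreal (t * (s + r))"
    using ex by (intro add_right_mono)
  also have "ennreal (t * (s + r)) = ennreal (t * s) + ennreal (t * r)"
    using s r t by (simp add: distrib_left)
  finally show ?thesis
    by (simp add: s r ac_simps)
qed

text \<open>
The optimal level \<open>s\<close> of the sum is used for both summands, which doubles the cost \<open>t * s\<close>; for
nonnegative numbers \<open>(a - s)\<^sub>+ + (b - s)\<^sub>+ \<le> (a + b - s)\<^sub>+\<close>.
\<close>

lemma Kfun_superadditive:
  assumes y: "y \<in> L1" and z: "z \<in> L1" and yz: "(\<lambda>u. y u + z u) \<in> L1" and t: "t > 0"
    and nonneg: "\<And>u. u > 0 \<Longrightarrow> 0 \<le> y u" "\<And>u. u > 0 \<Longrightarrow> 0 \<le> z u"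
  shows "Kfun y t + Kfun z t \<le> Kfun (\<lambda>u. y u + z u) (2 * t)"
proof -
  note [measurable] = L1_measurable[OF y] L1_measurable[OF z]
  obtain s where s: "s \<ge> 0"
      "Kfun (\<lambda>u. y u + z u) (2 * t) = excess (\<lambda>u. y u + z u) s + ennreal (2 * t * s)"
    using Kfun_attained[OF yz, of "2 * t"] t by auto
  have "excess y s + excess z s = (\<integral>\<^sup>+ u. ennreal (\<bar>y u\<bar> - s) + ennreal (\<bar>z u\<bar> - s) \<partial>halfline)"
    unfolding excess_def by (subst nn_integral_add) auto
  also have "\<dots> \<le> excess (\<lambda>u. y u + z u) s"
    unfolding excess_def
  proof (intro nn_integral_mono)
    fix u assume "u \<in> space halfline"
    then have "0 \<le> y u" "0 \<le> z u" using nonneg by auto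
    then have "ennreal (max 0 (\<bar>y u\<bar> - s) + max 0 (\<bar>z u\<bar> - s)) \<le> ennreal (max 0 (\<bar>y u + z u\<bar> - s))"
      using s by (intro ennreal_leI) (simp add: max_def)
    then show "ennreal (\<bar>y u\<bar> - s) + ennreal (\<bar>z u\<bar> - s) \<le> ennreal (\<bar>y u + z u\<bar> - s)"
      by (simp add: max_def ennreal_neg split: if_splits)
  qed
  finally have ex: "excess y s + excess z s \<le> excess (\<lambda>u. y u + z u) s" .
  have "Kfun y t + Kfun z t \<le> (excess y s + ennreal (t * s)) + (excess z s + ennreal (t * s))"
    using s t by (intro add_mono Kfun_le) auto
  also have "\<dots> = (excess y s + excess z s) + (ennreal (t * s) + ennreal (t * s))"
    by (simp add: ac_simps)
  also have "ennreal (t * s) + ennreal (t * s) = ennreal (2 * t * s)"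
    using s t by (simp flip: ennreal_plus)
  also have "(excess y s + excess z s) + ennreal (2 * t * s) \<le> Kfun (\<lambda>u. y u + z u) (2 * t)"
    unfolding s(2) using ex by (intro add_right_mono)
  finally show ?thesis .
qed

lemma Kfun_scale_le:
  assumes y: "y \<in> L1" and c: "c \<ge> 0" and t: "t > 0"
  shows "Kfun (\<lambda>u. c * y u) t \<le> ennreal c * Kfun y t"
proof -
  note [measurable] = L1_measurable[OF y]
  obtain s where s: "s \<ge> 0" "Kfun y t = excess y s + ennreal (t * s)"
    using Kfun_attained[OF y t] by blast
  have "Kfun (\<lambda>u. c * y u) t \<le> excess (\<lambda>u. c * y u) (c * s) + ennreal (t * (c * s))"
    using s t c by (intro Kfun_le) auto
  also have "excess (\<lambda>u. c * y u) (c * s) = (\<integral>\<^sup>+ u. ennreal c * ennreal (\<bar>y u\<bar> - s) \<partial>halfline)"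
    unfolding excess_def
    using c by (intro nn_integral_cong) (simp add: abs_mult ennreal_mult'[symmetric] flip: right_diff_distrib)
  also have "\<dots> = ennreal c * excess y s"
    unfolding excess_def by (rule nn_integral_cmult) auto
  also have "ennreal (t * (c * s)) = ennreal c * ennreal (t * s)"
    using c s t by (simp add: ennreal_mult[symmetric] ac_simps)
  finally show ?thesis
    by (simp add: s distrib_left)
qed

lemma Kfun_scale:
  assumes y: "y \<in> L1" and c: "c > 0" and t: "t > 0"
  shows "Kfun (\<lambda>u. c * y u) t = ennreal c * Kfun y t"
proof (rule antisym)
  show "Kfun (\<lambda>u. c * y u) t \<le> ennreal c * Kfun y t"
    using assms by (intro Kfun_scale_le) auto
  have "(\<lambda>u. c * y u) \<in> L1"
    using y by (simp add: L1_def)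
  from Kfun_scale_le[OF this, of "1 / c" t]
  have "Kfun y t \<le> ennreal (1 / c) * Kfun (\<lambda>u. c * y u) t"
    using c t by simp
  then have "ennreal c * Kfun y t \<le> ennreal c * (ennreal (1 / c) * Kfun (\<lambda>u. c * y u) t)"
    by (intro mult_left_mono) auto
  also have "\<dots> = Kfun (\<lambda>u. c * y u) t"
    using c by (simp add: mult.assoc[symmetric] ennreal_mult[symmetric])
  finally show "ennreal c * Kfun y t \<le> Kfun (\<lambda>u. c * y u) t" .
qed

section \<open>Functions whose level sets are initial segments\<close>

text \<open>
The shape shared by rearrangements and their truncated dilations: each set \<open>f > r\<close> with \<open>r \<ge> 0\<close> is an
interval starting at \<open>0\<close>, of length \<open>D r\<close>. It determines the distribution function at nonnegative levels, and hence the integrals over \<open>(0, t)\<close>.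
\<close>

definition level_profile :: "(real \<Rightarrow> real) \<Rightarrow> (real \<Rightarrow> ennreal) \<Rightarrow> bool" where
  "level_profile f D \<longleftrightarrow> (\<forall>u>0. 0 \<le> f u \<and> (\<forall>r\<ge>0. r < f u \<longleftrightarrow> ennreal u < D r))"

lemma level_profile_rearr: "y \<in> L1 \<Longrightarrow> level_profile (rearr y) (distfun y)"
  by (auto simp: level_profile_def rearr_nonneg less_rearr_iff)

lemma initial_segment:
  "\<exists>A\<in>sets borel. {u::real. 0 < u \<and> ennreal u < a} = A \<and> emeasure lborel A = a"
proof (cases a)
  case (real r)
  then have "{u::real. 0 < u \<and> ennreal u < a} = {0<..<r}"
    by (auto simp: ennreal_less_iff)
  then show ?thesis using real by auto
next
  case top
  have "ennreal (real n) \<le> emeasure lborel {0::real<..}" for n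
  proof -
    have "emeasure lborel {0<..<real n} \<le> emeasure lborel {0::real<..}"
      by (intro emeasure_mono) auto
    then show ?thesis by simp
  qed
  then have "(SUP n. of_nat n) \<le> emeasure lborel {0::real<..}"
    by (intro SUP_least) (simp add: ennreal_of_nat_eq_real_of_nat)
  then have "emeasure lborel {0::real<..} = \<infinity>"
    by (simp add: ennreal_SUP_of_nat_eq_top top_unique)
  moreover have "{u::real. 0 < u \<and> ennreal u < a} = {0<..}"
    using top by auto
  ultimately show ?thesis
    using top by (intro bexI[of _ "{0<..}"]) auto
qed

lemma level_profile_measurable:
  assumes "level_profile f D"
  shows "f \<in> borel_measurable halfline" "f \<in> borel_measurable (restrict_space lborel {0<..})"
proof -
  have *: "f \<in> borel_measurable (restrict_space lborel {0<..})"
    unfolding borel_measurable_iff_greater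
  proof
    fix r
    obtain A where A: "A \<in> sets borel" "{u::real. 0 < u \<and> ennreal u < D r} = A"
      using initial_segment by blast
    have "{u \<in> space (restrict_space lborel {0<..}). r < f u} = (if r \<ge> 0 then A else {0<..})"
      using assms A(2) unfolding level_profile_def by (auto simp: space_restrict_space)
    moreover have "A = A \<inter> {0<..}"
      using A(2) by auto
    ultimately show "{u \<in> space (restrict_space lborel {0<..}). r < f u} \<in> sets (restrict_space lborel {0<..})"
      using A(1) by (auto simp: sets_restrict_space)
  qed
  then show "f \<in> borel_measurable (restrict_space lborel {0<..})" .
  have "f \<in> borel_measurable (restrict_space borel {0<..})"
    using * by (simp cong: measurable_cong_sets add: measurable_def space_restrict_space sets_restrict_space)
  then have "(\<lambda>u. f u * indicator {0<..} u) \<in> borel_measurable borel"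
    by (subst (asm) borel_measurable_restrict_space_iff) (auto simp: mult.commute)
  then have "(\<lambda>u. f u * indicator {0<..} u) \<in> borel_measurable lebesgue"
    by (intro measurable_completion) simp
  then show "f \<in> borel_measurable halfline"
    by (subst borel_measurable_restrict_space_iff) (auto simp: mult.commute)
qed

lemma level_profile_distfun:
  assumes "level_profile f D" "r \<ge> 0"
  shows "distfun f r = D r"
proof -
  obtain A where A: "A \<in> sets borel" "{u::real. 0 < u \<and> ennreal u < D r} = A" "emeasure lborel A = D r"
    using initial_segment by blast
  have "{u. 0 < u \<and> r < \<bar>f u\<bar>} = A"
    using assms A(2) unfolding level_profile_def by auto
  moreover have "A \<subseteq> {0<..}" using A(2) by auto
  ultimately show ?thesis
    using A by (simp add: distfun_def emeasure_restrict_space)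
qed

lemma Kfun_level_profile:
  assumes "level_profile f D"
  shows "Kfun f t = (\<integral>\<^sup>+ s\<in>{0..}. min (D s) (ennreal t) \<partial>lborel)"
  unfolding Kfun_def
  by (intro nn_integral_cong) (simp add: indicator_def level_profile_distfun[OF assms])

lemma Kfun_rearr: "y \<in> L1 \<Longrightarrow> Kfun (rearr y) t = Kfun y t"
  using Kfun_level_profile[OF level_profile_rearr, of y t] by (simp add: Kfun_def)

lemma nn_integral_head_layer_cake:
  fixes f :: "real \<Rightarrow> real"
  assumes f: "f \<in> borel_measurable (restrict_space lborel {0<..})"
  shows "(\<integral>\<^sup>+ u\<in>{0<..<t}. ennreal (f u) \<partial>lborel) =
         (\<integral>\<^sup>+ r\<in>{0..}. emeasure lborel {u \<in> {0<..<t}. r < f u} \<partial>lborel)"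
proof -
  let ?M = "restrict_space lborel {0<..<t}"
  have eq: "?M = restrict_space (restrict_space lborel {0<..}) {0<..<t}"
    by (subst restrict_restrict_space) (auto intro!: arg_cong2[where f=restrict_space])
  have meas: "f \<in> borel_measurable ?M"
    unfolding eq by (rule measurable_restrict_space1[OF f])
  have "(\<integral>\<^sup>+ u\<in>{0<..<t}. ennreal (f u) \<partial>lborel) = (\<integral>\<^sup>+ u. ennreal (f u - 0) \<partial>?M)"
    by (subst nn_integral_restrict_space) auto
  also have "\<dots> = (\<integral>\<^sup>+ r\<in>{0..}. emeasure ?M {u \<in> space ?M. r < f u} \<partial>lborel)"
    by (intro layer_cake meas sigma_finite_measure_restrict_space lborel.sigma_finite_measure_axioms) auto
  also have "\<dots> = (\<integral>\<^sup>+ r\<in>{0..}. emeasure lborel {u \<in> {0<..<t}. r < f u} \<partial>lborel)"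
  proof (intro nn_integral_cong)
    fix r :: real
    have "{u \<in> space ?M. r < f u} = {u \<in> {0<..<t}. r < f u}"
      by (simp add: space_restrict_space)
    moreover have "emeasure ?M {u \<in> {0<..<t}. r < f u} = emeasure lborel {u \<in> {0<..<t}. r < f u}"
      by (rule emeasure_restrict_space) auto
    ultimately show "emeasure ?M {u \<in> space ?M. r < f u} * indicator {0..} r =
        emeasure lborel {u \<in> {0<..<t}. r < f u} * indicator {0..} r"
      by simp
  qed
  finally show ?thesis .
qed

text \<open>
Of the level sets inside \<open>(0, t)\<close>, the measure is at most \<open>t\<close> and at most that of the full level set.
\<close>

lemma nn_integral_head_le_Kfun:
  fixes f :: "real \<Rightarrow> real"
  assumes f: "f \<in> borel_measurable (restrict_space lborel {0<..})" and t: "t \<ge> 0"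
  shows "(\<integral>\<^sup>+ u\<in>{0<..<t}. ennreal (f u) \<partial>lborel) \<le> Kfun f t"
  unfolding nn_integral_head_layer_cake[OF f] Kfun_def
proof (intro nn_integral_mono mult_right_mono)
  fix r :: real
  let ?R = "restrict_space lborel {0<..} :: real measure"
  have "(\<lambda>u. \<bar>f u\<bar>) \<in> borel_measurable ?R"
    using f by (rule borel_measurable_abs)
  then have "{u \<in> space ?R. r < \<bar>f u\<bar>} \<in> sets ?R"
    unfolding borel_measurable_iff_greater by blast
  then have B: "{u \<in> {0<..}. r < \<bar>f u\<bar>} \<in> sets lborel"
    by (simp add: sets_restrict_space_iff space_restrict_space)
  have "emeasure lborel {u \<in> {0<..<t}. r < f u} \<le> emeasure lborel {u \<in> {0<..}. r < \<bar>f u\<bar>}"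
    by (intro emeasure_mono B) auto
  also have "\<dots> = emeasure halfline {u \<in> {0<..}. r < \<bar>f u\<bar>}"
    using B by (subst emeasure_restrict_space) auto
  also have "\<dots> = distfun f r"
    by (simp add: distfun_def)
  finally have 1: "emeasure lborel {u \<in> {0<..<t}. r < f u} \<le> distfun f r" .
  have "emeasure lborel {u \<in> {0<..<t}. r < f u} \<le> emeasure lborel {0<..<t}"
    by (intro emeasure_mono) auto
  then have "emeasure lborel {u \<in> {0<..<t}. r < f u} \<le> ennreal t"
    using t by simp
  with 1 show "emeasure lborel {u \<in> {0<..<t}. r < f u} \<le> min (distfun f r) (ennreal t)"
    by simp
qed auto

text \<open>
Here the level set inside \<open>(0, t)\<close> is the shorter of two initial segments, so the bound of the
preceding lemma is attained at every level.
\<close>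

lemma nn_integral_level_profile:
  assumes f: "level_profile f D" and t: "t \<ge> 0"
  shows "(\<integral>\<^sup>+ u\<in>{0<..<t}. ennreal (f u) \<partial>lborel) = Kfun f t"
  unfolding nn_integral_head_layer_cake[OF level_profile_measurable(2)[OF f]] Kfun_level_profile[OF f]
proof (intro nn_integral_cong)
  fix r :: real
  obtain A where A: "A \<in> sets borel" "{u::real. 0 < u \<and> ennreal u < min (D r) (ennreal t)} = A"
      "emeasure lborel A = min (D r) (ennreal t)"
    using initial_segment by blast
  have "{u \<in> {0<..<t}. r < f u} = A" if "r \<ge> 0"
  proof -
    have "r < f u \<and> u < t \<longleftrightarrow> ennreal u < min (D r) (ennreal t)" if "u > 0" for u
      using f that \<open>r \<ge> 0\<close> t by (simp add: level_profile_def ennreal_less_iff)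
    then show ?thesis
      unfolding A(2)[symmetric] by auto
  qed
  then show "emeasure lborel {u \<in> {0<..<t}. r < f u} * indicator {0..} r =
      min (D r) (ennreal t) * indicator {0..} r"
    using A by (auto simp: indicator_def)
qed

lemma integral_rearr:
  assumes "y \<in> L1" "t \<ge> 0"
  shows "(\<integral>\<^sup>+ u\<in>{0<..<t}. ennreal (rearr y u) \<partial>lborel) = Kfun y t"
  using nn_integral_level_profile[OF level_profile_rearr[OF assms(1)] assms(2)]
    Kfun_rearr[OF assms(1)] by simp

lemma Kfun_0 [simp]: "Kfun y 0 = 0"
  by (simp add: Kfun_def)

lemma submajorized_iff_Kfun:
  assumes "y \<in> L1" "z \<in> L1"
  shows "y \<prec>\<prec> z \<longleftrightarrow> (\<forall>t>0. Kfun y t \<le> Kfun z t)"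
proof -
  have "y \<prec>\<prec> z \<longleftrightarrow> (\<forall>t\<ge>0. Kfun y t \<le> Kfun z t)"
    unfolding submajorized_def using assms by (simp add: integral_rearr)
  also have "\<dots> \<longleftrightarrow> (\<forall>t>0. Kfun y t \<le> Kfun z t)"
    by (metis Kfun_0 order.order_iff_strict)
  finally show ?thesis .
qed

lemma L1_if_distfun_le:
  assumes f [measurable]: "f \<in> borel_measurable halfline" and y: "y \<in> L1"
    and le: "\<And>r. r \<ge> 0 \<Longrightarrow> distfun f r \<le> ennreal c * distfun y r"
  shows "f \<in> L1"
proof -
  note [measurable] = L1_measurable[OF y]
  have "(\<integral>\<^sup>+ u. ennreal (norm (f u)) \<partial>halfline) = (\<integral>\<^sup>+ r\<in>{0..}. distfun f r \<partial>lborel)"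
    using excess_layer_cake[of f 0] by (simp add: excess_def)
  also have "\<dots> \<le> (\<integral>\<^sup>+ r. ennreal c * (distfun y r * indicator {0..} r) \<partial>lborel)"
    using le by (intro nn_integral_mono) (auto simp: indicator_def)
  also have "\<dots> = ennreal c * excess y 0"
    by (subst nn_integral_cmult) (auto simp: excess_layer_cake)
  also have "\<dots> < \<infinity>"
    using excess_finite[OF y, of 0] by (simp add: ennreal_mult_less_top)
  finally show ?thesis
    unfolding L1_def integrable_iff_bounded using f by auto
qed

lemma rearr_in_L1:
  assumes y: "y \<in> L1"
  shows "rearr y \<in> L1"
proof (rule L1_if_distfun_le[OF _ y])
  show "rearr y \<in> borel_measurable halfline"
    by (rule level_profile_measurable(1)[OF level_profile_rearr[OF y]])
  show "distfun (rearr y) r \<le> ennreal 1 * distfun y r" if "r \<ge> 0" for r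
    using level_profile_distfun[OF level_profile_rearr[OF y] that] by simp
qed

section \<open>Truncated dilations of rearrangements\<close>

definition dilated_head :: "nat \<Rightarrow> (real \<Rightarrow> real) \<Rightarrow> real \<Rightarrow> real" where
  "dilated_head m y u = dilation (real m) (rearr y) u * indicator {0<..<1} u"

lemma level_profile_dilated_head:
  assumes y: "y \<in> L1" and m: "m > 0"
  shows "level_profile (dilated_head m y) (\<lambda>r. min (of_nat m * distfun y r) 1)"
  unfolding level_profile_def
proof (intro allI impI conjI)
  fix u r :: real assume u: "u > 0"
  have um: "u / real m > 0" using u m by simp
  show "0 \<le> dilated_head m y u"
    using rearr_nonneg[OF y um] by (simp add: dilated_head_def dilation_def)
  assume r: "r \<ge> 0"
  have "r < dilated_head m y u \<longleftrightarrow> u < 1 \<and> ennreal (u / real m) < distfun y r"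
    using u r less_rearr_iff[OF y um r] by (auto simp: dilated_head_def dilation_def indicator_def)
  also have "ennreal (u / real m) < distfun y r \<longleftrightarrow> ennreal u < of_nat m * distfun y r"
  proof (cases "distfun y r")
    case (real d)
    then show ?thesis
      using u m by (simp add: ennreal_of_nat_eq_real_of_nat ennreal_less_iff field_simps flip: ennreal_mult)
  next
    case top
    then show ?thesis
      using m by (simp add: ennreal_mult_top)
  qed
  also have "u < 1 \<longleftrightarrow> ennreal u < 1"
    using u by (simp add: ennreal_less_one_iff)
  finally show "r < dilated_head m y u \<longleftrightarrow> ennreal u < min (of_nat m * distfun y r) 1"
    by auto
qed

lemma dilated_head_in_L1:
  assumes y: "y \<in> L1" and m: "m > 0"
  shows "dilated_head m y \<in> L1"
proof (rule L1_if_distfun_le[OF _ y])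
  show "dilated_head m y \<in> borel_measurable halfline"
    by (rule level_profile_measurable(1)[OF level_profile_dilated_head[OF y m]])
  show "distfun (dilated_head m y) r \<le> ennreal (real m) * distfun y r" if "r \<ge> 0" for r
    using level_profile_distfun[OF level_profile_dilated_head[OF y m] that]
    by (simp add: ennreal_of_nat_eq_real_of_nat)
qed

lemma Kfun_dilated_head:
  assumes y: "y \<in> L1" and m: "m > 0" and t: "t \<ge> 0"
  shows "Kfun (dilated_head m y) t = of_nat m * Kfun y (min t 1 / real m)"
proof -
  note [measurable] = L1_measurable[OF y]
  define b where "b = min t 1 / real m"
  have b: "b \<ge> 0" "min t 1 = real m * b" using t m by (auto simp: b_def)
  have "min (min (of_nat m * d) 1) (ennreal t) = of_nat m * min d (ennreal b)" for d :: ennreal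
  proof -
    have "min 1 (ennreal t) = ennreal (min t 1)"
    proof (cases "t \<le> 1")
      case True
      then show ?thesis by (simp add: min_absorb1 min_absorb2 ennreal_le_1)
    next
      case False
      then show ?thesis by (simp add: min_absorb1 min_absorb2 ennreal_ge_1)
    qed
    then have "min (min (of_nat m * d) 1) (ennreal t) = min (of_nat m * d) (ennreal (min t 1))"
      by (simp add: min.assoc)
    also have "ennreal (min t 1) = of_nat m * ennreal b"
      using b by (simp add: ennreal_mult ennreal_of_nat_eq_real_of_nat)
    also have "min (of_nat m * d) (of_nat m * ennreal b) = of_nat m * min d (ennreal b)"
    proof (cases "d \<le> ennreal b")
      case True
      then show ?thesis by (simp add: min_absorb1 mult_left_mono)
    next
      case False
      then have "ennreal b \<le> d" by simp
      then show ?thesis by (simp add: min_absorb2 mult_left_mono)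
    qed
    finally show ?thesis .
  qed
  then have "Kfun (dilated_head m y) t = (\<integral>\<^sup>+ s. of_nat m * (min (distfun y s) (ennreal b) * indicator {0..} s) \<partial>lborel)"
    by (simp add: Kfun_level_profile[OF level_profile_dilated_head[OF y m]] mult.assoc)
  also have "\<dots> = of_nat m * Kfun y b"
    unfolding Kfun_def by (subst nn_integral_cmult) auto
  finally show ?thesis by (simp add: b_def)
qed

text \<open>
Replacing two functions by their rearrangements puts their large values in the same place, so that no
mass is lost in the sum. Thus \<open>Kfun y + Kfun z\<close> is itself bounded by \<open>Kfun\<close> of a single function.
\<close>

lemma Kfun_add_rearr:
  assumes y: "y \<in> L1" and z: "z \<in> L1" and t: "t \<ge> 0"
  shows "Kfun y t + Kfun z t \<le> Kfun (\<lambda>u. rearr y u + rearr z u) t"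
proof -
  let ?R = "restrict_space lborel {0<..} :: real measure"
  have meas: "rearr y \<in> borel_measurable ?R" "rearr z \<in> borel_measurable ?R"
    using level_profile_measurable(2)[OF level_profile_rearr] y z by auto
  have ind: "(\<lambda>u. ennreal (f u) * indicator {0<..<t} u) \<in> borel_measurable lborel"
    if "f \<in> borel_measurable ?R" for f
  proof -
    have "(\<lambda>u. f u * indicator {0<..} u) \<in> borel_measurable lborel"
      using that by (subst (asm) borel_measurable_restrict_space_iff) (simp_all add: mult.commute)
    then have "(\<lambda>u. ennreal (f u * indicator {0<..} u) * indicator {0<..<t} u) \<in> borel_measurable lborel"
      by measurable
    also have "(\<lambda>u. ennreal (f u * indicator {0<..} u) * indicator {0<..<t} u) = 
        (\<lambda>u. ennreal (f u) * indicator {0<..<t} u)"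
      by (auto simp: indicator_def)
    finally show ?thesis .
  qed
  have "Kfun y t + Kfun z t = (\<integral>\<^sup>+ u. ennreal (rearr y u) * indicator {0<..<t} u +
      ennreal (rearr z u) * indicator {0<..<t} u \<partial>lborel)"
  proof (subst nn_integral_add)
    show "(\<lambda>u. ennreal (rearr y u) * indicator {0<..<t} u) \<in> borel_measurable lborel"
      and "(\<lambda>u. ennreal (rearr z u) * indicator {0<..<t} u) \<in> borel_measurable lborel"
      by (rule ind[OF meas(1)], rule ind[OF meas(2)])
  qed (use y z t in \<open>simp add: integral_rearr\<close>)
  also have "\<dots> = (\<integral>\<^sup>+ u\<in>{0<..<t}. ennreal (rearr y u + rearr z u) \<partial>lborel)"
    using rearr_nonneg y z by (intro nn_integral_cong) (auto simp: indicator_def)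
  also have "\<dots> \<le> Kfun (\<lambda>u. rearr y u + rearr z u) t"
    using t meas by (intro nn_integral_head_le_Kfun borel_measurable_add)
  finally show ?thesis .
qed

lemma Kfun_bounded:
  assumes y: "y \<in> borel_measurable halfline" and C: "AE u in halfline. \<bar>y u\<bar> \<le> C" "C \<ge> 0" and t: "t \<ge> 0"
  shows "Kfun y t \<le> ennreal (C * t)"
proof -
  have "excess y C = (\<integral>\<^sup>+ u. 0 \<partial>halfline)"
    unfolding excess_def by (rule nn_integral_cong_AE) (use C in \<open>auto simp: ennreal_neg\<close>)
  then show ?thesis
    using Kfun_le[OF y C(2) t] by (simp add: mult.commute)
qed

text \<open>
Concavity of \<open>Kfun y\<close> in \<open>t\<close>, in the one instance of interest: the graph lies above its chord from \<open>0\<close>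
to \<open>1\<close>.
\<close>

lemma Kfun_ge_linear:
  assumes [measurable]: "y \<in> borel_measurable halfline" and t: "0 \<le> t" "t \<le> 1"
  shows "ennreal t * Kfun y 1 \<le> Kfun y t"
proof -
  have "ennreal t * Kfun y 1 = (\<integral>\<^sup>+ s. ennreal t * (min (distfun y s) (ennreal 1) * indicator {0..} s) \<partial>lborel)"
    unfolding Kfun_def by (subst nn_integral_cmult) auto
  also have "\<dots> \<le> Kfun y t"
    unfolding Kfun_def
  proof (intro nn_integral_mono)
    fix s
    have "ennreal t * min (distfun y s) 1 \<le> distfun y s"
      using mult_mono[of "ennreal t" 1 "min (distfun y s) 1" "distfun y s"] t by (simp add: ennreal_le_1)
    moreover have "ennreal t * min (distfun y s) 1 \<le> ennreal t"
      using mult_left_mono[of "min (distfun y s) 1" 1 "ennreal t"] by simp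
    ultimately show "ennreal t * (min (distfun y s) (ennreal 1) * indicator {0..} s) \<le>
        min (distfun y s) (ennreal t) * indicator {0..} s"
      by (auto simp: indicator_def)
  qed
  finally show ?thesis .
qed

lemma Kfun_mono_abs:
  assumes "f \<in> borel_measurable halfline" "g \<in> borel_measurable halfline"
    and "\<And>u. u > 0 \<Longrightarrow> \<bar>f u\<bar> \<le> \<bar>g u\<bar>"
  shows "Kfun f t \<le> Kfun g t"
proof -
  have "distfun f s \<le> distfun g s" for s
    unfolding distfun_def using assms(3)
    by (intro emeasure_mono superlevel_sets assms(2)) (auto intro: order_less_le_trans)
  then show ?thesis
    unfolding Kfun_def by (intro nn_integral_mono mult_right_mono min.mono) auto
qed

section \<open>A Hahn--Banach theorem for spaces of functions\<close>

definition function_space :: "('a \<Rightarrow> real) set \<Rightarrow> bool" where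
  "function_space V \<longleftrightarrow>
     (\<forall>f\<in>V. \<forall>g\<in>V. (\<lambda>t. f t + g t) \<in> V) \<and> (\<forall>c. \<forall>f\<in>V. (\<lambda>t. c * f t) \<in> V)"

definition sublinear_on :: "('a \<Rightarrow> real) set \<Rightarrow> (('a \<Rightarrow> real) \<Rightarrow> real) \<Rightarrow> bool" where
  "sublinear_on V p \<longleftrightarrow>
     (\<forall>f\<in>V. \<forall>g\<in>V. p (\<lambda>t. f t + g t) \<le> p f + p g) \<and>
     (\<forall>c>0. \<forall>f\<in>V. p (\<lambda>t. c * f t) \<le> c * p f)"

lemma function_spaceD:
  assumes "function_space V"
  shows "f \<in> V \<Longrightarrow> g \<in> V \<Longrightarrow> (\<lambda>t. f t + g t) \<in> V"
    and "f \<in> V \<Longrightarrow> (\<lambda>t. c * f t) \<in> V"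
    and "f \<in> V \<Longrightarrow> (\<lambda>t. - f t) \<in> V"
    and "f \<in> V \<Longrightarrow> g \<in> V \<Longrightarrow> (\<lambda>t. f t - g t) \<in> V"
    and "f \<in> V \<Longrightarrow> (\<lambda>t. 0) \<in> V"
proof -
  have add: "(\<lambda>t. f t + g t) \<in> V" if "f \<in> V" "g \<in> V" for f g
    using assms that by (auto simp: function_space_def)
  have scale: "(\<lambda>t. c * f t) \<in> V" if "f \<in> V" for c f
    using assms that by (auto simp: function_space_def)
  have neg: "(\<lambda>t. - f t) \<in> V" if "f \<in> V" for f
    using scale[OF that, of "-1"] by simp
  show "f \<in> V \<Longrightarrow> g \<in> V \<Longrightarrow> (\<lambda>t. f t + g t) \<in> V"
    and "f \<in> V \<Longrightarrow> (\<lambda>t. c * f t) \<in> V"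
    and "f \<in> V \<Longrightarrow> (\<lambda>t. - f t) \<in> V"
    using add scale neg by blast+
  show "f \<in> V \<Longrightarrow> g \<in> V \<Longrightarrow> (\<lambda>t. f t - g t) \<in> V"
    using add[OF _ neg, of f g] by simp
  show "f \<in> V \<Longrightarrow> (\<lambda>t. 0) \<in> V"
    using scale[of f 0] by simp
qed

lemma sublinear_onD:
  assumes "function_space V" "sublinear_on V p"
  shows "f \<in> V \<Longrightarrow> g \<in> V \<Longrightarrow> p (\<lambda>t. f t + g t) \<le> p f + p g"
    and "f \<in> V \<Longrightarrow> c > 0 \<Longrightarrow> p (\<lambda>t. c * f t) = c * p f"
    and "f \<in> V \<Longrightarrow> p (\<lambda>t. 0) = 0"
    and "f \<in> V \<Longrightarrow> - p (\<lambda>t. - f t) \<le> p f"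
proof -
  note V = function_spaceD[OF assms(1)]
  have sub: "p (\<lambda>t. f t + g t) \<le> p f + p g" if "f \<in> V" "g \<in> V" for f g
    using assms that by (auto simp: sublinear_on_def)
  have le: "p (\<lambda>t. c * f t) \<le> c * p f" if "f \<in> V" "c > 0" for c f
    using assms that by (auto simp: sublinear_on_def)
  show "f \<in> V \<Longrightarrow> g \<in> V \<Longrightarrow> p (\<lambda>t. f t + g t) \<le> p f + p g"
    by (fact sub)
  show "p (\<lambda>t. c * f t) = c * p f" if "f \<in> V" "c > 0"
  proof -
    have "p (\<lambda>t. (1 / c) * (c * f t)) \<le> (1 / c) * p (\<lambda>t. c * f t)"
      by (rule le) (use that V in auto)
    then show ?thesis
      using le[OF that] that by (auto simp: field_simps)
  qed
  have zero: "p (\<lambda>t. 0) = 0" if "f \<in> V" for f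
  proof -
    have "(\<lambda>t. 0) \<in> V"
      using V(5) that .
    then show ?thesis
      using sub[of "\<lambda>t. 0" "\<lambda>t. 0"] le[of "\<lambda>t. 0" "1/2"] by auto
  qed
  then show "f \<in> V \<Longrightarrow> p (\<lambda>t. 0) = 0" .
  show "- p (\<lambda>t. - f t) \<le> p f" if "f \<in> V"
    using sub[OF that V(3)[OF that]] zero[OF that] by simp
qed

text \<open>
With \<open>p' w\<close> the infimum over \<open>l \<ge> 0\<close> of \<open>p (w + l y) - l p y\<close>. For a minimal \<open>p\<close> the bound
\<open>p' w \<le> p (w + y) - p y\<close> yields superadditivity; the bound at \<open>- y\<close> makes every linear functional
below \<open>p'\<close> attain \<open>p\<close> at \<open>y\<close>.
\<close>

lemma sublinear_push_down:
  assumes V: "function_space V" and p: "sublinear_on V p" and y: "y \<in> V"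
  shows "\<exists>p'. sublinear_on V p' \<and> (\<forall>w\<in>V. p' w \<le> p w) \<and>
              (\<forall>w\<in>V. p' w \<le> p (\<lambda>t. w t + y t) - p y) \<and> p' (\<lambda>t. - y t) \<le> - p y"
proof -
  note VD = function_spaceD[OF V] and pD = sublinear_onD[OF V p]
  define r where "r w = (\<lambda>l. p (\<lambda>t. w t + l * y t) - l * p y)" for w and l :: real
  define p' where "p' w = (INF l\<in>{0..}. r w l)" for w
  have lower: "- p (\<lambda>t. - w t) \<le> r w l" if "w \<in> V" "l \<ge> 0" for w l
  proof -
    have "p (\<lambda>t. l * y t) \<le> p (\<lambda>t. w t + l * y t) + p (\<lambda>t. - w t)"
      using pD(1)[of "\<lambda>t. w t + l * y t" "\<lambda>t. - w t"] that y VD by simp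
    moreover have "p (\<lambda>t. l * y t) = l * p y"
      using pD(2,3)[OF y] that by (cases "l = 0") auto
    ultimately show ?thesis
      by (simp add: r_def)
  qed
  have bdd: "bdd_below (r w ` {0..})" if "w \<in> V" for w
    using lower[OF that] by (intro bdd_belowI) auto
  have upper: "p' w \<le> r w l" if "w \<in> V" "l \<ge> 0" for w l
    unfolding p'_def using bdd that by (intro cINF_lower) auto
  have greatest: "c \<le> p' w" if "\<And>l. l \<ge> 0 \<Longrightarrow> c \<le> r w l" for c w
    unfolding p'_def using that by (intro cINF_greatest) auto
  have "sublinear_on V p'"
    unfolding sublinear_on_def
  proof (intro conjI ballI allI impI)
    fix f g assume fg: "f \<in> V" "g \<in> V"
    have "p' (\<lambda>t. f t + g t) \<le> r f l + r g k" if "l \<ge> 0" "k \<ge> 0" for l k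
    proof -
      have "p' (\<lambda>t. f t + g t) \<le> r (\<lambda>t. f t + g t) (l + k)"
        using that VD fg by (intro upper) auto
      also have "\<dots> \<le> r f l + r g k"
        using pD(1)[of "\<lambda>t. f t + l * y t" "\<lambda>t. g t + k * y t"] VD fg y
        by (simp add: r_def algebra_simps)
      finally show ?thesis .
    qed
    then have "p' (\<lambda>t. f t + g t) - r f l \<le> p' g" if "l \<ge> 0" for l
      using that by (intro greatest) (auto simp: field_simps)
    then have "p' (\<lambda>t. f t + g t) - p' g \<le> p' f"
      by (intro greatest) (auto simp: field_simps)
    then show "p' (\<lambda>t. f t + g t) \<le> p' f + p' g"
      by simp
  next
    fix c :: real and f assume c: "c > 0" and f: "f \<in> V"
    have "p' (\<lambda>t. c * f t) \<le> c * r f l" if "l \<ge> 0" for l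
    proof -
      have "p' (\<lambda>t. c * f t) \<le> r (\<lambda>t. c * f t) (c * l)"
        using that VD f c by (intro upper) auto
      also have "\<dots> = c * r f l"
        using pD(2)[of "\<lambda>t. f t + l * y t" c] VD f y c
        by (simp add: r_def algebra_simps)
      finally show ?thesis .
    qed
    then have "p' (\<lambda>t. c * f t) / c \<le> p' f"
      using c by (intro greatest) (simp add: field_simps)
    then show "p' (\<lambda>t. c * f t) \<le> c * p' f"
      using c by (simp add: field_simps)
  qed
  moreover have "p' w \<le> p w" "p' w \<le> p (\<lambda>t. w t + y t) - p y" if "w \<in> V" for w
    using upper[OF that, of 0] upper[OF that, of 1] by (auto simp: r_def)
  moreover have "p' (\<lambda>t. - y t) \<le> - p y"
    using upper[of "\<lambda>t. - y t" 1] VD y pD(3)[OF y] by (auto simp: r_def)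
  ultimately show ?thesis
    by blast
qed

text \<open>
Zorn's lemma. The pointwise infimum of a chain is finite because \<open>p w \<ge> - p (- w) \<ge> - q (- w)\<close> for every
sublinear \<open>p \<le> q\<close>.
\<close>

lemma minimal_sublinear_exists:
  fixes V :: "('a \<Rightarrow> real) set"
  assumes V: "function_space V" and q: "sublinear_on V q"
  shows "\<exists>m. sublinear_on V m \<and> (\<forall>w\<in>V. m w \<le> q w) \<and>
             (\<forall>p. sublinear_on V p \<longrightarrow> (\<forall>w\<in>V. p w \<le> m w) \<longrightarrow> (\<forall>w\<in>V. p w = m w))"
proof -
  note VD = function_spaceD[OF V]
  \<comment> \<open>Values outside \<open>V\<close> are pinned to \<open>0\<close> so that the pointwise order is antisymmetric.\<close>
  define A where "A = {p. sublinear_on V p \<and> (\<forall>w\<in>V. p w \<le> q w) \<and> (\<forall>w. w \<notin> V \<longrightarrow> p w = 0)}"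
  define R where "R p p' \<longleftrightarrow> (\<forall>w. p' w \<le> p w)" for p p' :: "('a \<Rightarrow> real) \<Rightarrow> real"
  define restr where "restr p w = (if w \<in> V then p w else 0)" for p :: "('a \<Rightarrow> real) \<Rightarrow> real" and w
  have restr: "sublinear_on V (restr p)" if "sublinear_on V p" for p
    using that VD unfolding sublinear_on_def restr_def by auto
  have po: "partial_order_on A (relation_of R A)"
    by (rule partial_order_on_relation_ofI) (auto simp: R_def fun_eq_iff intro: order_trans antisym)
  have "\<exists>m\<in>A. \<forall>a\<in>A. R m a \<longrightarrow> a = m"
  proof (rule predicate_Zorn[OF po])
    fix C assume C: "C \<in> Chains (relation_of R A)"
    have CA: "p \<in> A" if "p \<in> C" for p
      using C that by (auto simp: Chains_def relation_of_def)
    have lin: "R p p' \<or> R p' p" if "p \<in> C" "p' \<in> C" for p p'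
      using C that by (auto simp: Chains_def relation_of_def)
    show "\<exists>u\<in>A. \<forall>a\<in>C. R a u"
    proof (cases "C = {}")
      case True
      have "restr q \<in> A"
        using restr[OF q] by (auto simp: A_def restr_def)
      then show ?thesis
        using True by blast
    next
      case False
      define u where "u w = (if w \<in> V then INF p\<in>C. p w else 0)" for w
      have bdd: "bdd_below ((\<lambda>p. p w) ` C)" if w: "w \<in> V" for w
      proof (intro bdd_belowI)
        fix z assume "z \<in> (\<lambda>p. p w) ` C"
        then obtain p where p: "p \<in> C" "z = p w" by auto
        have "sublinear_on V p" "p (\<lambda>t. - w t) \<le> q (\<lambda>t. - w t)"
          using CA[OF p(1)] w VD by (auto simp: A_def)
        then show "- q (\<lambda>t. - w t) \<le> z"
          using sublinear_onD(4)[OF V _ w, of p] p by linarith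
      qed
      have up: "u w \<le> p w" if "p \<in> C" "w \<in> V" for p w
        using that bdd unfolding u_def by (auto intro!: cINF_lower)
      have gr: "c \<le> u w" if "\<And>p. p \<in> C \<Longrightarrow> c \<le> p w" "w \<in> V" for c w
        using that False unfolding u_def by (auto intro!: cINF_greatest)
      have "sublinear_on V u"
        unfolding sublinear_on_def
      proof (intro conjI ballI allI impI)
        fix f g assume fg: "f \<in> V" "g \<in> V"
        have "u (\<lambda>t. f t + g t) \<le> p f + p' g" if pp: "p \<in> C" "p' \<in> C" for p p'
        proof -
          \<comment> \<open>The smaller of the two members of the chain serves for both summands.\<close>
          obtain s where s: "s \<in> C" "s f \<le> p f" "s g \<le> p' g"
            using lin[OF pp] pp unfolding R_def by blast
          have "u (\<lambda>t. f t + g t) \<le> s (\<lambda>t. f t + g t)"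
            using s fg VD by (intro up) auto
          also have "\<dots> \<le> s f + s g"
            using CA[OF s(1)] fg by (auto simp: A_def sublinear_on_def)
          finally show ?thesis using s by linarith
        qed
        then have "u (\<lambda>t. f t + g t) - p f \<le> p' g" if "p \<in> C" "p' \<in> C" for p p'
          using that by (metis diff_le_eq add.commute)
        then have "u (\<lambda>t. f t + g t) - p f \<le> u g" if "p \<in> C" for p
          using that fg by (intro gr)
        then have "u (\<lambda>t. f t + g t) - u g \<le> u f"
          using fg by (intro gr) (auto simp: field_simps)
        then show "u (\<lambda>t. f t + g t) \<le> u f + u g"
          by simp
      next
        fix c :: real and f assume c: "c > 0" and f: "f \<in> V"
        have "u (\<lambda>t. c * f t) \<le> c * p f" if "p \<in> C" for p
        proof -
          have "u (\<lambda>t. c * f t) \<le> p (\<lambda>t. c * f t)"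
            using that f VD by (intro up) auto
          also have "\<dots> \<le> c * p f"
            using CA[OF that] f c by (auto simp: A_def sublinear_on_def)
          finally show ?thesis .
        qed
        then have "u (\<lambda>t. c * f t) / c \<le> u f"
          using c f by (intro gr) (simp_all add: field_simps)
        then show "u (\<lambda>t. c * f t) \<le> c * u f"
          using c by (simp add: field_simps)
      qed
      moreover have "u w \<le> q w" if "w \<in> V" for w
      proof -
        obtain p where "p \<in> C"
          using False by blast
        then show ?thesis
          using up[of p w] CA[of p] that by (force simp: A_def)
      qed
      ultimately have "u \<in> A"
        by (auto simp: A_def u_def)
      moreover have "R p u" if "p \<in> C" for p
        unfolding R_def
      proof
        fix w
        show "u w \<le> p w"
          using up[OF that, of w] CA[OF that] by (cases "w \<in> V") (auto simp: A_def u_def)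
      qed
      ultimately show ?thesis
        by blast
    qed
  qed
  then obtain m where m: "m \<in> A" "\<And>a. a \<in> A \<Longrightarrow> R m a \<Longrightarrow> a = m"
    by blast
  have "p w = m w" if p: "sublinear_on V p" "\<forall>w\<in>V. p w \<le> m w" and w: "w \<in> V" for p w
  proof -
    have "\<forall>w\<in>V. p w \<le> q w"
      using p m(1) by (force simp: A_def)
    then have "restr p \<in> A"
      using restr[OF p(1)] by (auto simp: A_def restr_def)
    moreover have "R m (restr p)"
      using p m(1) by (auto simp: A_def R_def restr_def)
    ultimately have "restr p = m"
      using m(2) by blast
    then show ?thesis
      using w by (auto simp: restr_def)
  qed
  then show ?thesis
    using m(1) by (intro exI[of _ m]) (auto simp: A_def)
qed

text \<open>
A minimal sublinear functional is linear, since it cannot be pushed down along any direction. Starting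
from \<open>q\<close> pushed down along \<open>x\<close> forces the value at \<open>x\<close>.
\<close>

theorem hahn_banach_attained:
  assumes V: "function_space V" and q: "sublinear_on V q" and x: "x \<in> V"
  obtains L where "\<And>f g. f \<in> V \<Longrightarrow> g \<in> V \<Longrightarrow> L (\<lambda>t. f t + g t) = L f + L g"
    and "\<And>c f. f \<in> V \<Longrightarrow> L (\<lambda>t. c * f t) = c * L f"
    and "\<And>f. f \<in> V \<Longrightarrow> L f \<le> q f"
    and "L x = q x"
proof -
  note VD = function_spaceD[OF V]
  obtain p where p: "sublinear_on V p" "\<forall>w\<in>V. p w \<le> q w" "p (\<lambda>t. - x t) \<le> - q x"
    using sublinear_push_down[OF V q x] by blast
  obtain m where m: "sublinear_on V m" "\<forall>w\<in>V. m w \<le> p w"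
    and min: "\<And>p w. sublinear_on V p \<Longrightarrow> \<forall>w\<in>V. p w \<le> m w \<Longrightarrow> w \<in> V \<Longrightarrow> p w = m w"
    using minimal_sublinear_exists[OF V p(1)] by blast
  note mD = sublinear_onD[OF V m(1)]
  have add: "m (\<lambda>t. f t + g t) = m f + m g" if fg: "f \<in> V" "g \<in> V" for f g
  proof -
    obtain r where r: "sublinear_on V r" "\<forall>w\<in>V. r w \<le> m w" "r f \<le> m (\<lambda>t. f t + g t) - m g"
      using sublinear_push_down[OF V m(1) fg(2)] fg by blast
    have "r f = m f"
      using min r(1,2) fg(1) by blast
    then show ?thesis
      using r(3) mD(1)[OF fg] by linarith
  qed
  have neg: "m (\<lambda>t. - f t) = - m f" if "f \<in> V" for f
    using add[OF that VD(3)[OF that]] mD(3)[OF that] by simp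
  have scale: "m (\<lambda>t. c * f t) = c * m f" if "f \<in> V" for c f
  proof -
    consider "c = 0" | "c > 0" | "c < 0" by linarith
    then show ?thesis
    proof cases
      case 1 then show ?thesis using mD(3)[OF that] by simp
    next
      case 2 then show ?thesis using mD(2)[OF that] by simp
    next
      case 3
      have "m (\<lambda>t. - (- c * f t)) = - m (\<lambda>t. - c * f t)"
        by (rule neg) (rule VD(2)[OF that])
      also have "\<dots> = c * m f"
        using mD(2)[OF that, of "- c"] 3 by simp
      finally show ?thesis by simp
    qed
  qed
  have le: "m f \<le> q f" if "f \<in> V" for f
    using m(2) p(2) that by force
  have "m (\<lambda>t. - x t) \<le> - q x"
    using m(2) p(3) VD(3)[OF x] by force
  then have "m x = q x"
    using neg[OF x] le[OF x] by linarith
  then show ?thesis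
    using that[of m] add scale le by blast
qed

section \<open>Integrals of the largest values as real functions\<close>

text \<open>
The functions of \<open>t\<close> to which the Hahn--Banach theorem is applied are real-valued; for \<open>y\<close> in \<open>L1\<close> the
values of \<open>Kfun y\<close> are finite.
\<close>

definition head :: "(real \<Rightarrow> real) \<Rightarrow> real \<Rightarrow> real" where
  "head y t = enn2real (Kfun y t)"

lemma ennreal_head: "y \<in> L1 \<Longrightarrow> t \<ge> 0 \<Longrightarrow> ennreal (head y t) = Kfun y t"
  unfolding head_def using Kfun_finite by (simp add: less_top)

lemma head_nonneg [simp]: "0 \<le> head y t"
  by (simp add: head_def)

lemma head_le_iff:
  assumes "y \<in> L1" "z \<in> L1" "s \<ge> 0" "t \<ge> 0"
  shows "head y s \<le> head z t \<longleftrightarrow> Kfun y s \<le> Kfun z t"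
proof -
  have "head y s \<le> head z t \<longleftrightarrow> ennreal (head y s) \<le> ennreal (head z t)"
    by simp
  then show ?thesis
    using assms by (simp add: ennreal_head)
qed

lemma head_mono:
  assumes "y \<in> L1" "0 \<le> s" "s \<le> t"
  shows "head y s \<le> head y t"
  using assms Kfun_mono[of s t y] by (subst head_le_iff) auto

lemma head_zero [simp]:
  assumes "t \<ge> 0"
  shows "head (\<lambda>u. 0) t = 0"
proof -
  have "Kfun (\<lambda>u. 0) t \<le> ennreal (0 * t)"
    using assms by (intro Kfun_bounded) auto
  then show ?thesis
    by (simp add: head_def)
qed

lemma L1_add: "y \<in> L1 \<Longrightarrow> z \<in> L1 \<Longrightarrow> (\<lambda>u. y u + z u) \<in> L1"
  and L1_scale: "y \<in> L1 \<Longrightarrow> (\<lambda>u. c * y u) \<in> L1"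
  and L1_pos: "y \<in> L1 \<Longrightarrow> (\<lambda>u. max (y u) 0) \<in> L1"
  by (simp_all add: L1_def)

lemma head_subadditive:
  assumes "y \<in> L1" "z \<in> L1" "t > 0"
  shows "head (\<lambda>u. y u + z u) t \<le> head y t + head z t"
proof -
  have "ennreal (head (\<lambda>u. y u + z u) t) \<le> ennreal (head y t + head z t)"
    using Kfun_subadditive[OF assms] assms by (simp add: ennreal_head L1_add)
  then show ?thesis by (subst (asm) ennreal_le_iff) auto
qed

lemma head_superadditive:
  assumes "y \<in> L1" "z \<in> L1" "t > 0"
    and "\<And>u. u > 0 \<Longrightarrow> 0 \<le> y u" "\<And>u. u > 0 \<Longrightarrow> 0 \<le> z u"
  shows "head y (t / 2) + head z (t / 2) \<le> head (\<lambda>u. y u + z u) t"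
proof -
  have "ennreal (head y (t / 2) + head z (t / 2)) \<le> ennreal (head (\<lambda>u. y u + z u) t)"
    using Kfun_superadditive[of y z "t / 2"] assms by (simp add: ennreal_head L1_add)
  then show ?thesis by (subst (asm) ennreal_le_iff) auto
qed

lemma head_scale:
  assumes "y \<in> L1" "c \<ge> 0" "t > 0"
  shows "head (\<lambda>u. c * y u) t = c * head y t"
proof (cases "c = 0")
  case False
  then show ?thesis
    using assms by (simp add: head_def Kfun_scale enn2real_mult)
qed (use assms in simp)

lemma head_dilated_head:
  assumes "y \<in> L1" "m > 0" "t \<ge> 0"
  shows "head (dilated_head m y) t = real m * head y (min t 1 / real m)"
  using assms by (simp add: head_def Kfun_dilated_head enn2real_mult ennreal_of_nat_eq_real_of_nat)

lemma head_add_rearr: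
  assumes "y \<in> L1" "z \<in> L1" "t \<ge> 0"
  shows "head y t + head z t \<le> head (\<lambda>u. rearr y u + rearr z u) t"
proof -
  have "ennreal (head y t + head z t) \<le> ennreal (head (\<lambda>u. rearr y u + rearr z u) t)"
    using Kfun_add_rearr[OF assms] assms by (simp add: ennreal_head L1_add rearr_in_L1)
  then show ?thesis by (subst (asm) ennreal_le_iff) auto
qed

lemma head_bounded:
  assumes "y \<in> L1" "AE u in halfline. \<bar>y u\<bar> \<le> C" "C \<ge> 0" "t \<ge> 0"
  shows "head y t \<le> C * t"
proof -
  have "ennreal (head y t) \<le> ennreal (C * t)"
    using Kfun_bounded[OF L1_measurable[OF assms(1)] assms(2-4)] assms by (simp add: ennreal_head)
  then show ?thesis using assms by (simp add: ennreal_le_iff)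
qed

lemma head_ge_linear:
  assumes "y \<in> L1" "0 \<le> t" "t \<le> 1"
  shows "t * head y 1 \<le> head y t"
proof -
  have "ennreal (t * head y 1) \<le> ennreal (head y t)"
    using Kfun_ge_linear[OF L1_measurable[OF assms(1)] assms(2,3)] assms
    by (simp add: ennreal_head ennreal_mult)
  then show ?thesis by (subst (asm) ennreal_le_iff) auto
qed

lemma head_cong_AE:
  assumes "y \<in> L1" "z \<in> L1" "AE u in halfline. y u = z u"
  shows "head y = head z"
proof -
  have "distfun y = distfun z"
    using assms by (intro distfun_cong_AE L1_measurable)
  then show ?thesis
    by (simp add: fun_eq_iff head_def Kfun_def)
qed

text \<open>
The factor \<open>1 / m\<close> compensates the dilation: near \<open>0\<close>, compression only rescales the argument of
\<open>head y\<close>.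
\<close>

definition compressed :: "nat \<Rightarrow> (real \<Rightarrow> real) \<Rightarrow> real \<Rightarrow> real" where
  "compressed m y = (\<lambda>u. 1 / real m * dilated_head m y u)"

lemma head_compressed:
  assumes "y \<in> L1" "m > 0" "t > 0"
  shows "head (compressed m y) t = head y (min t 1 / real m)"
proof -
  have "head (compressed m y) t = 1 / real m * head (dilated_head m y) t"
    unfolding compressed_def using assms by (intro head_scale dilated_head_in_L1) auto
  then show ?thesis
    using assms by (simp add: head_dilated_head)
qed

text \<open>
Averaging over dyadic dilations builds invariance under \<open>t \<mapsto> t / 2\<close> into the sublinear functional
below. For \<open>n = 0\<close> the value is \<open>0\<close>.
\<close>

definition mean :: "nat \<Rightarrow> (real \<Rightarrow> real) \<Rightarrow> real \<Rightarrow> real" where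
  "mean n F t = (1 / real n) * (\<Sum>k<n. F (t / 2 ^ k))"

lemma mean_add: "mean n (\<lambda>t. F t + G t) t = mean n F t + mean n G t"
  by (simp add: mean_def sum.distrib distrib_left)

lemma mean_scale: "mean n (\<lambda>t. c * F t) t = c * mean n F t"
  by (simp add: mean_def sum_distrib_left algebra_simps)

lemma mean_le:
  assumes "\<And>k. k < n \<Longrightarrow> F (t / 2 ^ k) \<le> c" "0 \<le> c"
  shows "mean n F t \<le> c"
proof (cases "n = 0")
  case False
  have "(\<Sum>k<n. F (t / 2 ^ k)) \<le> real n * c"
    using sum_bounded_above[of "{..<n}" "\<lambda>k. F (t / 2 ^ k)" c] assms(1) by simp
  then show ?thesis
    using False by (simp add: mean_def field_simps)
qed (simp add: mean_def assms)

lemma mean_ge: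
  assumes "\<And>k. k < n \<Longrightarrow> c \<le> F (t / 2 ^ k)" "n > 0"
  shows "c \<le> mean n F t"
proof -
  have "real n * c \<le> (\<Sum>k<n. F (t / 2 ^ k))"
    using sum_bounded_below[of "{..<n}" c "\<lambda>k. F (t / 2 ^ k)"] assms(1) by simp
  then show ?thesis
    using assms(2) by (simp add: mean_def field_simps)
qed

lemma mean_telescope: "mean n (\<lambda>t. F t - F (t / 2)) t = (F t - F (t / 2 ^ n)) / real n"
proof -
  have "(\<Sum>k<n. F (t / 2 ^ k) - F (t / 2 ^ k / 2)) = F t - F (t / 2 ^ n)"
    by (induction n) (auto simp: field_simps)
  then show ?thesis
    by (simp add: mean_def)
qed

section \<open>Fully symmetric spaces of integrable functions\<close>

locale fully_symmetric_L1 =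
  fixes E :: "(real \<Rightarrow> real) set" and N :: "(real \<Rightarrow> real) \<Rightarrow> real"
  assumes fs: "fully_symmetric_Banach_space E N" and sub_L1: "E \<subseteq> L1"
begin

lemma in_L1 [simp, intro]: "y \<in> E \<Longrightarrow> y \<in> L1"
  using sub_L1 by blast

lemma zero_in [simp]: "(\<lambda>t. 0) \<in> E"
  and add_in: "y \<in> E \<Longrightarrow> z \<in> E \<Longrightarrow> (\<lambda>t. y t + z t) \<in> E"
  and N_add: "y \<in> E \<Longrightarrow> z \<in> E \<Longrightarrow> N (\<lambda>t. y t + z t) \<le> N y + N z"
  and scale_in: "y \<in> E \<Longrightarrow> (\<lambda>t. c * y t) \<in> E"
  and N_scale: "y \<in> E \<Longrightarrow> N (\<lambda>t. c * y t) = \<bar>c\<bar> * N y"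
  and N_nonneg: "y \<in> E \<Longrightarrow> 0 \<le> N y"
  using fs unfolding fully_symmetric_Banach_space_def by blast+

lemma N_zero [simp]: "N (\<lambda>t. 0) = 0"
  using N_scale[OF zero_in, of 0] by simp

lemma majorant:
  assumes x: "x \<in> E" and y: "y \<in> L1" and le: "\<And>t. t > 0 \<Longrightarrow> head y t \<le> head x t"
  shows "y \<in> E" "N y \<le> N x"
proof -
  have "y \<prec>\<prec> x"
    using le x y by (simp add: submajorized_iff_Kfun head_le_iff)
  moreover have "y \<in> L1_plus_Linf"
  proof -
    have "(\<lambda>t. 0) \<in> Linf"
      by (auto simp: Linf_def)
    then show ?thesis
      using y unfolding L1_plus_Linf_def by force
  qed
  ultimately have "y \<in> E \<and> N y \<le> N x"
    using fs x unfolding fully_symmetric_Banach_space_def by blast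
  then show "y \<in> E" "N y \<le> N x" by auto
qed

lemma dominated_in:
  assumes x: "x \<in> E" and y: "y \<in> L1" and le: "\<And>u. u > 0 \<Longrightarrow> \<bar>y u\<bar> \<le> \<bar>x u\<bar>"
  shows "y \<in> E"
  using x y by (intro majorant(1)[OF x]) (auto simp: head_le_iff intro!: Kfun_mono_abs le L1_measurable)

text \<open>
The element is \<open>\<mu>(h) + \<mu>(k)\<close>. It makes the families of functions dominated by some \<open>head h\<close> closed
under addition, at no cost in the norm.
\<close>

lemma head_sum_attained:
  assumes "h \<in> E" "k \<in> E"
  obtains u where "u \<in> E" "N u \<le> N h + N k" "\<And>t. t > 0 \<Longrightarrow> head h t + head k t \<le> head u t"
proof -
  have r: "rearr y \<in> E" "N (rearr y) \<le> N y" if "y \<in> E" for y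
    using that by (auto intro!: majorant[of y] rearr_in_L1 simp: head_def Kfun_rearr)
  show thesis
  proof (rule that)
    show "(\<lambda>u. rearr h u + rearr k u) \<in> E"
      using r assms by (intro add_in)
    show "N (\<lambda>u. rearr h u + rearr k u) \<le> N h + N k"
      using N_add[OF r(1)[OF assms(1)] r(1)[OF assms(2)]] r(2)[OF assms(1)] r(2)[OF assms(2)]
      by linarith
    show "head h t + head k t \<le> head (\<lambda>u. rearr h u + rearr k u) t" if "t > 0" for t
      using assms that by (intro head_add_rearr) auto
  qed
qed

lemma dilated_head_in:
  assumes y: "y \<in> E" and m: "m > 0"
  shows "dilated_head m y \<in> E"
proof (rule majorant(1))
  show "(\<lambda>u. real m * y u) \<in> E"
    using y by (rule scale_in)
  show "dilated_head m y \<in> L1"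
    using y m by (intro dilated_head_in_L1) auto
  fix t :: real assume t: "t > 0"
  have "min t 1 / real m \<le> t"
    using t m by (simp add: divide_le_eq min_le_iff_disj) 
  then show "head (dilated_head m y) t \<le> head (\<lambda>u. real m * y u) t"
    using y m t by (auto simp: head_dilated_head head_scale intro!: mult_left_mono head_mono)
qed

lemma compressed_in: "y \<in> E \<Longrightarrow> m > 0 \<Longrightarrow> compressed m y \<in> E"
  unfolding compressed_def by (intro scale_in dilated_head_in)

lemma N_compressed: "y \<in> E \<Longrightarrow> m > 0 \<Longrightarrow> N (compressed m y) = 1 / real m * N (dilated_head m y)"
  unfolding compressed_def using N_scale[OF dilated_head_in, of y m "1 / real m"] by simp

lemma N_compressed_antimono:
  assumes y: "y \<in> E" and mn: "0 < n" "n \<le> m"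
  shows "N (compressed m y) \<le> N (compressed n y)"
proof (rule majorant(2))
  show "compressed n y \<in> E" "compressed m y \<in> L1"
    using compressed_in[OF y, of n] compressed_in[OF y, of m] mn by auto
  fix t :: real assume t: "t > 0"
  then show "head (compressed m y) t \<le> head (compressed n y) t"
    using y mn by (auto simp: head_compressed intro!: head_mono divide_left_mono)
qed

definition limit_norm :: "(real \<Rightarrow> real) \<Rightarrow> real" where
  "limit_norm y = lim (\<lambda>m. N (compressed m y))"

lemma limit_norm:
  assumes y: "y \<in> E"
  shows "(\<lambda>m. N (compressed m y)) \<longlonglongrightarrow> limit_norm y"
    and "m > 0 \<Longrightarrow> limit_norm y \<le> N (compressed m y)"
proof -
  define a where "a n = N (compressed (Suc n) y)" for n
  have "decseq a"
    unfolding decseq_def a_def using y by (auto intro!: N_compressed_antimono)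
  moreover have "0 \<le> a n" for n
    unfolding a_def by (intro N_nonneg compressed_in y) auto
  ultimately obtain l where l: "a \<longlonglongrightarrow> l" "\<And>n. l \<le> a n"
    using decseq_convergent[of a 0] by metis
  have lim: "(\<lambda>m. N (compressed m y)) \<longlonglongrightarrow> l"
    using l(1) unfolding a_def by (rule LIMSEQ_imp_Suc)
  then have eq: "limit_norm y = l"
    unfolding limit_norm_def by (rule limI)
  show "(\<lambda>m. N (compressed m y)) \<longlonglongrightarrow> limit_norm y"
    using lim eq by simp
  show "m > 0 \<Longrightarrow> limit_norm y \<le> N (compressed m y)"
    using l(2)[of "m - 1"] eq by (simp add: a_def)
qed

text \<open>
The functions \<open>head (dilated_head m y)\<close> are bounded by \<open>C * min t 1\<close> uniformly in \<open>m\<close>, and concavity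
gives \<open>head y t \<ge> min t 1 * head y 1\<close>. So all \<open>dilated_head m y\<close> are submajorized by one multiple of
\<open>y\<close>, and dividing by \<open>m\<close> sends the norms to \<open>0\<close>. If \<open>head y 1 = 0\<close>, the dilations vanish almost
everywhere.
\<close>

lemma limit_norm_bounded:
  assumes y: "y \<in> E" and bound: "AE u in halfline. \<bar>y u\<bar> \<le> C" and C: "C \<ge> 0"
  shows "limit_norm y = 0"
proof -
  have "\<exists>B. \<forall>m>0. N (dilated_head m y) \<le> B"
  proof (cases "head y 1 = 0")
    case True
    have "N (dilated_head m y) \<le> N (\<lambda>t. 0)" if m: "m > 0" for m
    proof (rule majorant(2))
      show "dilated_head m y \<in> L1"
        using dilated_head_in[OF y m] by auto
      fix t :: real assume t: "t > 0"
      have "head y (min t 1 / real m) \<le> head y 1"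
        using y m t by (intro head_mono) (auto simp: divide_le_eq)
      then have "head y (min t 1 / real m) = 0"
        using True by (intro antisym) auto
      then show "head (dilated_head m y) t \<le> head (\<lambda>t. 0) t"
        using y m t by (simp add: head_dilated_head)
    qed simp
    then show ?thesis by blast
  next
    case False
    define c where "c = C / head y 1"
    have pos: "head y 1 > 0"
      using False head_nonneg[of y 1] by linarith
    have c: "c \<ge> 0"
      using C by (simp add: c_def)
    have "N (dilated_head m y) \<le> N (\<lambda>t. c * y t)" if m: "m > 0" for m
    proof (rule majorant(2))
      show "(\<lambda>t. c * y t) \<in> E"
        using y by (rule scale_in)
      show "dilated_head m y \<in> L1"
        using dilated_head_in[OF y m] by auto
      fix t :: real assume t: "t > 0"
      have "head (dilated_head m y) t = real m * head y (min t 1 / real m)"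
        using y m t by (simp add: head_dilated_head)
      also have "\<dots> \<le> real m * (C * (min t 1 / real m))"
        using y m t C bound by (intro mult_left_mono head_bounded) auto
      also have "\<dots> = c * (min t 1 * head y 1)"
        using m pos by (simp add: c_def)
      also have "\<dots> \<le> c * head y (min t 1)"
        using c y t by (intro mult_left_mono head_ge_linear) auto
      also have "\<dots> \<le> c * head y t"
        using c y t by (intro mult_left_mono head_mono) auto
      finally show "head (dilated_head m y) t \<le> head (\<lambda>t. c * y t) t"
        using y c t by (simp add: head_scale)
    qed
    then show ?thesis by blast
  qed
  then obtain B where B: "\<And>m. m > 0 \<Longrightarrow> N (dilated_head m y) \<le> B"
    by blast
  have "(\<lambda>m. N (compressed m y)) \<longlonglongrightarrow> 0"
  proof (rule tendsto_sandwich[of "\<lambda>m. 0" _ _ "\<lambda>m. B / real m"])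
    show "\<forall>\<^sub>F m in sequentially. 0 \<le> N (compressed m y)"
      using eventually_gt_at_top[of 0] by eventually_elim (intro N_nonneg compressed_in y)
    show "\<forall>\<^sub>F m in sequentially. N (compressed m y) \<le> B / real m"
      using eventually_gt_at_top[of 0]
      by eventually_elim (use B y in \<open>simp add: N_compressed divide_right_mono\<close>)
  qed (auto intro: lim_const_over_n)
  then show ?thesis
    using limit_norm(1)[OF y] LIMSEQ_unique by blast
qed

section \<open>The sublinear functional of dyadic means\<close>

text \<open>
The bound is on \<open>(0, 1]\<close>, the interval to which compression truncates.
\<close>

definition head_dominated :: "(real \<Rightarrow> real) set" where
  "head_dominated = {F. \<exists>h\<in>E. \<forall>t\<in>{0<..1}. \<bar>F t\<bar> \<le> head h t}"

text \<open>
Domination is required of all sufficiently long averages, so that the sum of two majorants dominates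
the averages of the sum.
\<close>

definition mean_majorants :: "(real \<Rightarrow> real) \<Rightarrow> (real \<Rightarrow> real) set" where
  "mean_majorants F = {h\<in>E. \<exists>M. \<forall>n\<ge>M. \<forall>t\<in>{0<..1}. mean n F t \<le> head h t}"

definition mean_norm :: "(real \<Rightarrow> real) \<Rightarrow> real" where
  "mean_norm F = Inf (N ` mean_majorants F)"

lemma mean_majorantsI:
  assumes "h \<in> E" "\<And>n t. n \<ge> M \<Longrightarrow> 0 < t \<Longrightarrow> t \<le> 1 \<Longrightarrow> mean n F t \<le> head h t"
  shows "h \<in> mean_majorants F"
  using assms unfolding mean_majorants_def by (auto intro!: exI[of _ M])

lemma function_space_head_dominated: "function_space head_dominated"
  unfolding function_space_def
proof (intro conjI ballI allI)
  fix F G assume "F \<in> head_dominated" "G \<in> head_dominated"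
  then obtain h k where hk: "h \<in> E" "k \<in> E"
      "\<And>t. t \<in> {0<..1} \<Longrightarrow> \<bar>F t\<bar> \<le> head h t" "\<And>t. t \<in> {0<..1} \<Longrightarrow> \<bar>G t\<bar> \<le> head k t"
    unfolding head_dominated_def by blast
  obtain u where u: "u \<in> E" "\<And>t. t > 0 \<Longrightarrow> head h t + head k t \<le> head u t"
    using head_sum_attained[OF hk(1,2)] by blast
  have "\<bar>F t + G t\<bar> \<le> head u t" if "t \<in> {0<..1}" for t
    using hk(3,4)[OF that] u(2)[of t] that abs_triangle_ineq[of "F t" "G t"] by auto
  then show "(\<lambda>t. F t + G t) \<in> head_dominated"
    using u(1) unfolding head_dominated_def by blast
next
  fix c :: real and F assume "F \<in> head_dominated"
  then obtain h where h: "h \<in> E" "\<And>t. t \<in> {0<..1} \<Longrightarrow> \<bar>F t\<bar> \<le> head h t"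
    unfolding head_dominated_def by blast
  have "\<bar>c * F t\<bar> \<le> head (\<lambda>u. \<bar>c\<bar> * h u) t" if "t \<in> {0<..1}" for t
    using h that by (auto simp: abs_mult head_scale intro!: mult_left_mono)
  then show "(\<lambda>t. c * F t) \<in> head_dominated"
    using scale_in[OF h(1), of "\<bar>c\<bar>"] unfolding head_dominated_def by blast
qed

lemma head_in_head_dominated:
  assumes "y \<in> E"
  shows "head y \<in> head_dominated" "(\<lambda>t. head y (t / 2)) \<in> head_dominated"
  using assms unfolding head_dominated_def by (auto intro!: bexI[of _ y] head_mono)

lemma mean_majorants_nonempty:
  assumes "F \<in> head_dominated"
  shows "mean_majorants F \<noteq> {}"
proof -
  obtain h where h: "h \<in> E" "\<And>t. t \<in> {0<..1} \<Longrightarrow> \<bar>F t\<bar> \<le> head h t"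
    using assms unfolding head_dominated_def by blast
  have "mean n F t \<le> head h t" if t: "0 < t" "t \<le> 1" for n t
  proof (rule mean_le)
    fix k
    have "t / 2 ^ k \<le> t"
      using t by (simp add: divide_le_eq mult_le_cancel_left1)
    moreover from this have "t / 2 ^ k \<in> {0<..1}"
      using t by (simp del: divide_le_eq_1_pos)
    ultimately have "F (t / 2 ^ k) \<le> head h (t / 2 ^ k)" "head h (t / 2 ^ k) \<le> head h t"
      using h(2)[of "t / 2 ^ k"] h(1) t by (fastforce, intro head_mono, auto)
    then show "F (t / 2 ^ k) \<le> head h t"
      by linarith
  qed simp
  then have "h \<in> mean_majorants F"
    using h(1) by (intro mean_majorantsI) auto
  then show ?thesis by blast
qed

lemma mean_norm_le: "h \<in> mean_majorants F \<Longrightarrow> mean_norm F \<le> N h"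
  unfolding mean_norm_def
  by (intro cInf_lower bdd_belowI[of _ 0]) (auto simp: mean_majorants_def N_nonneg)

lemma mean_norm_ge:
  "F \<in> head_dominated \<Longrightarrow> (\<And>h. h \<in> mean_majorants F \<Longrightarrow> c \<le> N h) \<Longrightarrow> c \<le> mean_norm F"
  unfolding mean_norm_def using mean_majorants_nonempty by (intro cInf_greatest) auto

lemma sublinear_mean_norm: "sublinear_on head_dominated mean_norm"
  unfolding sublinear_on_def
proof (intro conjI ballI allI impI)
  fix F G assume FG: "F \<in> head_dominated" "G \<in> head_dominated"
  have "mean_norm (\<lambda>t. F t + G t) \<le> N h + N k"
    if h: "h \<in> mean_majorants F" and k: "k \<in> mean_majorants G" for h k
  proof -
    obtain M M' where M: "\<And>n t. n \<ge> M \<Longrightarrow> t \<in> {0<..1} \<Longrightarrow> mean n F t \<le> head h t"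
        "\<And>n t. n \<ge> M' \<Longrightarrow> t \<in> {0<..1} \<Longrightarrow> mean n G t \<le> head k t" and hk: "h \<in> E" "k \<in> E"
      using h k unfolding mean_majorants_def by blast
    obtain u where u: "u \<in> E" "N u \<le> N h + N k" "\<And>t. t > 0 \<Longrightarrow> head h t + head k t \<le> head u t"
      using head_sum_attained[OF hk] by blast
    have "u \<in> mean_majorants (\<lambda>t. F t + G t)"
    proof (rule mean_majorantsI[OF u(1), of "max M M'"])
      fix n t assume "max M M' \<le> n" "0 < t" "t \<le> (1::real)"
      then show "mean n (\<lambda>t. F t + G t) t \<le> head u t"
        using M(1)[of n t] M(2)[of n t] u(3)[of t] by (simp add: mean_add)
    qed
    then show ?thesis
      using mean_norm_le u(2) by fastforce
  qed
  then have "mean_norm (\<lambda>t. F t + G t) - N h \<le> N k"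
    if "h \<in> mean_majorants F" "k \<in> mean_majorants G" for h k
    using that by (metis diff_le_eq add.commute)
  then have "mean_norm (\<lambda>t. F t + G t) - N h \<le> mean_norm G" if "h \<in> mean_majorants F" for h
    using that FG by (intro mean_norm_ge)
  then have "mean_norm (\<lambda>t. F t + G t) - mean_norm G \<le> mean_norm F"
    using FG by (intro mean_norm_ge) (auto simp: diff_le_eq add.commute)
  then show "mean_norm (\<lambda>t. F t + G t) \<le> mean_norm F + mean_norm G"
    by simp
next
  fix c :: real and F assume c: "c > 0" and F: "F \<in> head_dominated"
  have "mean_norm (\<lambda>t. c * F t) / c \<le> N h" if h: "h \<in> mean_majorants F" for h
  proof -
    obtain M where M: "\<And>n t. n \<ge> M \<Longrightarrow> t \<in> {0<..1} \<Longrightarrow> mean n F t \<le> head h t" and hE: "h \<in> E"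
      using h unfolding mean_majorants_def by blast
    have "(\<lambda>t. c * h t) \<in> mean_majorants (\<lambda>t. c * F t)"
      using M c hE by (intro mean_majorantsI[of _ M] scale_in) (auto simp: mean_scale head_scale)
    then have "mean_norm (\<lambda>t. c * F t) \<le> c * N h"
      using mean_norm_le N_scale[OF hE, of c] c by fastforce
    then show ?thesis
      using c by (simp add: field_simps)
  qed
  then have "mean_norm (\<lambda>t. c * F t) / c \<le> mean_norm F"
    using F by (intro mean_norm_ge) auto
  then show "mean_norm (\<lambda>t. c * F t) \<le> c * mean_norm F"
    using c by (simp add: field_simps)
qed

text \<open>
Lower bound: all terms of the \<open>n\<close>-th average at \<open>t\<close> are at least \<open>head y (t / 2 ^ n)\<close>, which is \<open>head\<close> of
a compression; so any majorant of the averages has norm at least that of this compression.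
Upper bound: all but the first \<open>j\<close> terms are at most \<open>head y (t / 2 ^ j)\<close>, and those first terms contribute
at most \<open>(j / n) * head y t\<close>, which for large \<open>n\<close> is absorbed by a small multiple of \<open>y\<close>.
\<close>

lemma mean_norm_head:
  assumes y: "y \<in> E"
  shows "mean_norm (head y) = limit_norm y"
proof (rule antisym)
  show "limit_norm y \<le> mean_norm (head y)"
  proof (rule mean_norm_ge[OF head_in_head_dominated(1)[OF y]])
    fix h assume "h \<in> mean_majorants (head y)"
    then obtain M where M: "\<And>n t. n \<ge> M \<Longrightarrow> t \<in> {0<..1} \<Longrightarrow> mean n (head y) t \<le> head h t"
        and h: "h \<in> E"
      unfolding mean_majorants_def by blast
    define n where "n = Suc M"
    have "N (compressed (2 ^ n) y) \<le> N h"
    proof (rule majorant(2)[OF h])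
      show "compressed (2 ^ n) y \<in> L1"
        using compressed_in[OF y, of "2 ^ n"] by auto
      fix t :: real assume t: "t > 0"
      have "head (compressed (2 ^ n) y) t = head y (min t 1 / 2 ^ n)"
        using y t by (simp add: head_compressed)
      also have "\<dots> \<le> mean n (head y) (min t 1)"
        using y t by (intro mean_ge head_mono divide_left_mono power_increasing) (auto simp: n_def)
      also have "\<dots> \<le> head h (min t 1)"
        using t by (intro M) (auto simp: n_def)
      also have "\<dots> \<le> head h t"
        using h t by (intro head_mono) auto
      finally show "head (compressed (2 ^ n) y) t \<le> head h t" .
    qed
    then show "limit_norm y \<le> N h"
      using limit_norm(2)[OF y, of "2 ^ n"] by simp
  qed
  show "mean_norm (head y) \<le> limit_norm y"
  proof (rule field_le_epsilon)
    fix e :: real assume e: "e > 0"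
    \<comment> \<open>The summand \<open>1\<close> only prevents a division by zero.\<close>
    define d where "d = e / (2 * (N y + 1))"
    have Ny: "N y \<ge> 0" using N_nonneg[OF y] .
    have d: "d > 0" "d * N y \<le> e / 2"
      using e Ny by (auto simp: d_def field_simps)
    have "\<forall>\<^sub>F m in sequentially. N (compressed m y) < limit_norm y + e / 2"
      using limit_norm(1)[OF y] e by (intro order_tendstoD) auto
    then obtain j where j: "\<And>m. m \<ge> j \<Longrightarrow> N (compressed m y) < limit_norm y + e / 2"
      unfolding eventually_sequentially by blast
    define z where "z = compressed (2 ^ j) y"
    have z: "z \<in> E" "N z < limit_norm y + e / 2"
      unfolding z_def using j[of "2 ^ j"] by (auto intro!: compressed_in y)
    obtain u where u: "u \<in> E" "N u \<le> N z + N (\<lambda>t. d * y t)"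
        "\<And>t. t > 0 \<Longrightarrow> head z t + head (\<lambda>t. d * y t) t \<le> head u t"
      using head_sum_attained[OF z(1) scale_in[OF y]] by blast
    obtain M where M: "real j / d \<le> real M"
      using real_arch_simple by blast
    have "u \<in> mean_majorants (head y)"
    proof (rule mean_majorantsI[OF u(1), of "Suc (max M j)"])
      fix n t assume n: "Suc (max M j) \<le> n" and t: "0 < t" "t \<le> (1::real)"
      let ?a = "head y (t / 2 ^ j)" and ?b = "head y t"
      have "(\<Sum>k<n. head y (t / 2 ^ k)) \<le> (\<Sum>k<n. ?a + (if k < j then ?b else 0))"
      proof (rule sum_mono)
        fix k
        show "head y (t / 2 ^ k) \<le> ?a + (if k < j then ?b else 0)"
        proof (cases "k < j")
          case True
          have "head y (t / 2 ^ k) \<le> ?b"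
            using y t by (intro head_mono) (auto simp: divide_le_eq mult_le_cancel_left1)
          then show ?thesis
            using True by (simp add: add_increasing)
        next
          case False
          then show ?thesis
            using y t by (auto intro!: head_mono divide_left_mono)
        qed
      qed
      also have "\<dots> = real n * ?a + real j * ?b"
      proof -
        have "{..<n} \<inter> {k. k < j} = {..<j}"
          using n by auto
        then show ?thesis
          by (simp add: sum.distrib sum.If_cases)
      qed
      finally have "mean n (head y) t \<le> ?a + real j / real n * ?b"
        using n by (simp add: mean_def field_simps)
      also have "real j / real n \<le> d"
      proof -
        have "real j / d \<le> real n"
          using M n by linarith
        then show ?thesis
          using d(1) n by (simp add: field_simps)
      qed
      then have "?a + real j / real n * ?b \<le> ?a + d * ?b"
        by (intro add_left_mono mult_right_mono) auto
      also have "\<dots> = head z t + head (\<lambda>t. d * y t) t"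
        using y t d(1) by (simp add: z_def head_compressed head_scale)
      also have "\<dots> \<le> head u t"
        using u(3) t by blast
      finally show "mean n (head y) t \<le> head u t" .
    qed
    then have "mean_norm (head y) \<le> N z + d * N y"
      using mean_norm_le u(2) N_scale[OF y, of d] d(1) by fastforce
    then show "mean_norm (head y) \<le> limit_norm y + e"
      using z(2) d(2) by linarith
  qed
qed

lemma mean_norm_nonpos:
  assumes "\<And>t. t \<in> {0<..1} \<Longrightarrow> F t \<le> 0"
  shows "mean_norm F \<le> 0"
proof -
  have "(\<lambda>t. 0) \<in> mean_majorants F"
  proof (intro mean_majorantsI[of _ 0])
    fix n t assume t: "0 < t" "t \<le> (1::real)"
    show "mean n F t \<le> head (\<lambda>t. 0) t"
    proof (rule mean_le)
      fix k
      have "t \<le> 2 ^ k"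
        using t(2) one_le_power[of "2::real" k] by linarith
      then have "F (t / 2 ^ k) \<le> 0"
        using t by (intro assms) auto
      then show "F (t / 2 ^ k) \<le> head (\<lambda>t. 0) t"
        using t by simp
    qed simp
  qed simp
  then show ?thesis
    using mean_norm_le by force
qed

text \<open>
The averages telescope to \<open>(head y t - head y (t / 2 ^ n)) / n\<close>, which is at most \<open>head y t / n\<close>.
\<close>

lemma mean_norm_dilation:
  assumes y: "y \<in> E"
  shows "mean_norm (\<lambda>t. head y t - head y (t / 2)) \<le> 0"
proof (rule field_le_epsilon)
  fix e :: real assume e: "e > 0"
  obtain M where M: "N y / e \<le> real M"
    using real_arch_simple by blast
  define c where "c = 1 / real (Suc M)"
  have c: "c > 0" by (simp add: c_def)
  have "(\<lambda>u. c * y u) \<in> mean_majorants (\<lambda>t. head y t - head y (t / 2))"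
  proof (rule mean_majorantsI[of _ "Suc M"])
    show "(\<lambda>u. c * y u) \<in> E"
      using y by (rule scale_in)
    fix n t assume n: "Suc M \<le> n" and t: "0 < t" "t \<le> (1::real)"
    have "mean n (\<lambda>t. head y t - head y (t / 2)) t \<le> head y t / real n"
      unfolding mean_telescope by (intro divide_right_mono) auto
    also have "\<dots> \<le> head y t / real (Suc M)"
      using n by (intro divide_left_mono) (auto simp: mult_pos_pos)
    also have "\<dots> = head (\<lambda>u. c * y u) t"
      using y t c by (simp add: head_scale) (simp add: c_def)
    finally show "mean n (\<lambda>t. head y t - head y (t / 2)) t \<le> head (\<lambda>u. c * y u) t" .
  qed
  then have "mean_norm (\<lambda>t. head y t - head y (t / 2)) \<le> c * N y"
    using mean_norm_le N_scale[OF y, of c] c by fastforce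
  also have "\<dots> \<le> e"
  proof -
    have "N y \<le> e * real M"
      using M e by (simp add: field_simps)
    also have "\<dots> \<le> e * real (Suc M)"
      using e by simp
    finally show ?thesis
      by (simp add: c_def field_simps)
  qed
  finally show "mean_norm (\<lambda>t. head y t - head y (t / 2)) \<le> 0 + e"
    by simp
qed

end

section \<open>From linear functionals on means to symmetric functionals\<close>

context fully_symmetric_L1
begin

definition pos_part :: "(real \<Rightarrow> real) \<Rightarrow> real \<Rightarrow> real" where
  "pos_part y = (\<lambda>u. max (y u) 0)"

definition neg_part :: "(real \<Rightarrow> real) \<Rightarrow> real \<Rightarrow> real" where
  "neg_part y = (\<lambda>u. max (- y u) 0)"

lemma pos_part_in: "y \<in> E \<Longrightarrow> pos_part y \<in> E"
  unfolding pos_part_def by (rule dominated_in[of y]) (auto simp: L1_pos)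

lemma neg_part_in: "y \<in> E \<Longrightarrow> neg_part y \<in> E"
  using pos_part_in[OF scale_in[of y "-1"]] by (simp add: pos_part_def neg_part_def)

lemma parts_nonneg [simp]: "0 \<le> pos_part y u" "0 \<le> neg_part y u"
  by (auto simp: pos_part_def neg_part_def)

text \<open>
Linearity on \<open>E\<close> reduces to additivity on nonnegative functions. There, \<open>L (head (a + b))\<close> is squeezed
between \<open>L\<close> of \<open>head a + head b\<close> and \<open>L\<close> of its dilation \<open>\<lambda>t. head a (t / 2) + head b (t / 2)\<close>,
and the domination by \<open>mean_norm\<close> makes the latter no smaller than the former.
\<close>

lemma linear_functional_of_head:
  assumes add: "\<And>f g. f \<in> head_dominated \<Longrightarrow> g \<in> head_dominated \<Longrightarrow> L (\<lambda>t. f t + g t) = L f + L g"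
    and scale: "\<And>c f. f \<in> head_dominated \<Longrightarrow> L (\<lambda>t. c * f t) = c * L f"
    and le: "\<And>f. f \<in> head_dominated \<Longrightarrow> L f \<le> mean_norm f"
  defines "\<phi> \<equiv> \<lambda>y. L (head (pos_part y)) - L (head (neg_part y))"
  shows "linear_functional E \<phi>" "fully_symmetric_functional E \<phi>" "singular_functional E \<phi>"
    and "\<And>y. y \<in> E \<Longrightarrow> AE u in halfline. 0 \<le> y u \<Longrightarrow> \<phi> y = L (head y)"
proof -
  note VD = function_spaceD[OF function_space_head_dominated]
  note hd = head_in_head_dominated
  have diff: "L (\<lambda>t. f t - g t) = L f - L g" if "f \<in> head_dominated" "g \<in> head_dominated" for f g
    using add[OF that(1) VD(2)[OF that(2), of "-1"]] scale[OF that(2), of "-1"] by simp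
  have mono: "L f \<le> L g"
    if fg: "f \<in> head_dominated" "g \<in> head_dominated" and "\<And>t. 0 < t \<Longrightarrow> t \<le> 1 \<Longrightarrow> f t \<le> g t" for f g
  proof -
    have "L (\<lambda>t. f t - g t) \<le> mean_norm (\<lambda>t. f t - g t)"
      using fg by (intro le VD)
    also have "\<dots> \<le> 0"
      using that(3) by (intro mean_norm_nonpos) auto
    finally show ?thesis
      using diff[OF fg] by simp
  qed
  have zero: "L (head (\<lambda>u. 0)) = 0"
  proof -
    have z: "(\<lambda>t::real. 0::real) \<in> head_dominated"
      using VD(5)[OF hd(1)[OF zero_in]] .
    have "L (head (\<lambda>u. 0)) = L (\<lambda>t. 0)"
      using z hd(1)[OF zero_in] by (intro antisym mono) auto
    also have "\<dots> = 0"
      using scale[OF z, of 0] by simp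
    finally show ?thesis .
  qed
  have nonneg: "0 \<le> L (head a)" if "a \<in> E" for a
    using mono[of "head (\<lambda>u. 0)" "head a"] zero that hd by simp
  have halve: "L (head a) \<le> L (\<lambda>t. head a (t / 2))" if a: "a \<in> E" for a
  proof -
    have "L (\<lambda>t. head a t - head a (t / 2)) \<le> mean_norm (\<lambda>t. head a t - head a (t / 2))"
      using hd[OF a] by (intro le VD)
    then show ?thesis
      using diff[OF hd[OF a]] mean_norm_dilation[OF a] by linarith
  qed
  have cone_add: "L (head (\<lambda>u. a u + b u)) = L (head a) + L (head b)"
    if ab: "a \<in> E" "b \<in> E" "\<And>u. 0 \<le> a u" "\<And>u. 0 \<le> b u" for a b
  proof (rule antisym)
    note s = add_in[OF ab(1,2)]
    have "L (head (\<lambda>u. a u + b u)) \<le> L (\<lambda>t. head a t + head b t)"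
      using ab s by (intro mono hd VD head_subadditive) auto
    then show "L (head (\<lambda>u. a u + b u)) \<le> L (head a) + L (head b)"
      using add[OF hd(1)[OF ab(1)] hd(1)[OF ab(2)]] by simp
    have "L (\<lambda>t. head a (t / 2) + head b (t / 2)) \<le> L (head (\<lambda>u. a u + b u))"
      using ab s by (intro mono hd VD head_superadditive) auto
    then show "L (head a) + L (head b) \<le> L (head (\<lambda>u. a u + b u))"
      using add[OF hd(2)[OF ab(1)] hd(2)[OF ab(2)]] halve[OF ab(1)] halve[OF ab(2)] by linarith
  qed
  have cone_scale: "L (head (\<lambda>u. c * a u)) = c * L (head a)" if a: "a \<in> E" and c: "c \<ge> 0" for a c
  proof -
    have "L (head (\<lambda>u. c * a u)) = L (\<lambda>t. c * head a t)"
      using a c by (intro antisym mono hd VD scale_in) (auto simp: head_scale)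
    then show ?thesis
      using scale[OF hd(1)[OF a]] by simp
  qed
  have null: "L (head a) = 0" if a: "a \<in> E" and "AE u in halfline. a u = 0" for a
    using head_cong_AE[of a "\<lambda>u. 0"] that zero by auto
  show on_cone: "\<phi> y = L (head y)" if y: "y \<in> E" and "AE u in halfline. 0 \<le> y u" for y
  proof -
    have "head (pos_part y) = head y"
      using that pos_part_in[OF y] by (intro head_cong_AE) (auto simp: pos_part_def)
    moreover have "L (head (neg_part y)) = 0"
      using that by (intro null neg_part_in) (auto simp: neg_part_def)
    ultimately show ?thesis
      by (simp add: \<phi>_def)
  qed
  have phi_add: "\<phi> (\<lambda>t. y t + z t) = \<phi> y + \<phi> z" if yz: "y \<in> E" "z \<in> E" for y z
  proof -
    let ?s = "\<lambda>t. y t + z t"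
    have s: "?s \<in> E" using yz by (rule add_in)
    note parts = pos_part_in[OF s] pos_part_in[OF yz(1)] pos_part_in[OF yz(2)]
      neg_part_in[OF s] neg_part_in[OF yz(1)] neg_part_in[OF yz(2)]
    have "L (head (pos_part ?s)) + (L (head (neg_part y)) + L (head (neg_part z))) =
        L (head (\<lambda>u. pos_part ?s u + (neg_part y u + neg_part z u)))"
      using parts by (simp add: cone_add add_in)
    also have "(\<lambda>u. pos_part ?s u + (neg_part y u + neg_part z u)) =
        (\<lambda>u. neg_part ?s u + (pos_part y u + pos_part z u))"
      by (auto simp: pos_part_def neg_part_def max_def)
    also have "L (head \<dots>) = L (head (neg_part ?s)) + (L (head (pos_part y)) + L (head (pos_part z)))"
      using parts by (simp add: cone_add add_in)
    finally show ?thesis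
      by (simp add: \<phi>_def)
  qed
  have phi_scale: "\<phi> (\<lambda>t. c * y t) = c * \<phi> y" if y: "y \<in> E" for c y
  proof (cases "c \<ge> 0")
    case True
    then have "pos_part (\<lambda>t. c * y t) = (\<lambda>u. c * pos_part y u)"
      and "neg_part (\<lambda>t. c * y t) = (\<lambda>u. c * neg_part y u)"
      by (auto simp: pos_part_def neg_part_def max_mult_distrib_left)
    then show ?thesis
      using True y by (simp add: \<phi>_def cone_scale pos_part_in neg_part_in right_diff_distrib)
  next
    case False
    then have "pos_part (\<lambda>t. c * y t) = (\<lambda>u. - c * neg_part y u)"
      and "neg_part (\<lambda>t. c * y t) = (\<lambda>u. - c * pos_part y u)"
      by (auto simp: pos_part_def neg_part_def max_mult_distrib_left)
    then show ?thesis
      using False y cone_scale[of _ "- c"]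
      by (simp add: \<phi>_def pos_part_in neg_part_in right_diff_distrib)
  qed
  have phi_AE: "\<phi> y = \<phi> z" if "y \<in> E" "z \<in> E" "AE t in halfline. y t = z t" for y z
  proof -
    have "head (pos_part y) = head (pos_part z)" "head (neg_part y) = head (neg_part z)"
      using that pos_part_in neg_part_in
      by (intro head_cong_AE; auto simp: pos_part_def neg_part_def)+
    then show ?thesis
      by (simp add: \<phi>_def)
  qed
  show "linear_functional E \<phi>"
    unfolding linear_functional_def using phi_add phi_scale phi_AE by blast
  show "fully_symmetric_functional E \<phi>"
    unfolding fully_symmetric_functional_def
  proof (intro ballI impI)
    fix x y assume xy: "x \<in> E" "y \<in> E" "y \<prec>\<prec> x"
      and nn: "AE t in halfline. 0 \<le> x t" "AE t in halfline. 0 \<le> y t"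
    have "head y t \<le> head x t" if "t > 0" for t
      using xy that by (auto simp: submajorized_iff_Kfun head_le_iff)
    then have "L (head y) \<le> L (head x)"
      using xy by (intro mono hd) auto
    then show "\<phi> y \<le> \<phi> x"
      using on_cone xy(1,2) nn by simp
  qed
  have bounded: "L (head a) = 0"
    if a: "a \<in> E" and "AE u in halfline. \<bar>a u\<bar> \<le> C" "C \<ge> 0" for a C
    using le[OF hd(1)[OF a]] mean_norm_head[OF a] limit_norm_bounded[OF that] nonneg[OF a] by simp
  show "singular_functional E \<phi>"
    unfolding singular_functional_def
  proof
    fix y assume y: "y \<in> E \<inter> (L1 \<inter> Linf)"
    then obtain C where C: "AE u in halfline. \<bar>y u\<bar> \<le> C"
      by (auto simp: Linf_def)
    have "AE u in halfline. \<bar>pos_part y u\<bar> \<le> max C 0" "AE u in halfline. \<bar>neg_part y u\<bar> \<le> max C 0"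
      using C by (auto simp: pos_part_def neg_part_def)
    then show "\<phi> y = 0"
      using bounded[of "pos_part y" "max C 0"] bounded[of "neg_part y" "max C 0"] y
      by (simp add: \<phi>_def pos_part_in neg_part_in)
  qed
qed

end

theorem theorem35:
  fixes E :: "(real \<Rightarrow> real) set" and N :: "(real \<Rightarrow> real) \<Rightarrow> real" and x :: "real \<Rightarrow> real"
  assumes "fully_symmetric_Banach_space E N"
    and "E \<subseteq> L1"
    and "x \<in> E"
    and "AE t in halfline. 0 \<le> x t"
  shows "\<exists>\<phi>. linear_functional E \<phi> \<and> fully_symmetric_functional E \<phi> \<and> singular_functional E \<phi> \<and>
    (\<lambda>m::nat. 1 / real m * N (\<lambda>t. dilation (real m) (rearr x) t * indicator {0<..<1} t))
      \<longlonglongrightarrow> \<phi> x"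
proof -
  interpret fully_symmetric_L1 E N
    by unfold_locales (fact assms)+
  note x = assms(3,4)
  obtain L where L: "\<And>f g. f \<in> head_dominated \<Longrightarrow> g \<in> head_dominated \<Longrightarrow> L (\<lambda>t. f t + g t) = L f + L g"
      "\<And>c f. f \<in> head_dominated \<Longrightarrow> L (\<lambda>t. c * f t) = c * L f"
      "\<And>f. f \<in> head_dominated \<Longrightarrow> L f \<le> mean_norm f"
      "L (head x) = mean_norm (head x)"
    using hahn_banach_attained[OF function_space_head_dominated sublinear_mean_norm
        head_in_head_dominated(1)[OF x(1)]] by blast
  define \<phi> where "\<phi> = (\<lambda>y. L (head (pos_part y)) - L (head (neg_part y)))"
  have \<phi>: "linear_functional E \<phi>" "fully_symmetric_functional E \<phi>" "singular_functional E \<phi>"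
      "\<phi> x = L (head x)"
    unfolding \<phi>_def using x by (blast intro: linear_functional_of_head[of L] L(1-3))+
  have "\<phi> x = limit_norm x"
    using \<phi>(4) L(4) mean_norm_head[OF x(1)] by simp
  then have "(\<lambda>m. N (compressed m x)) \<longlonglongrightarrow> \<phi> x"
    using limit_norm(1)[OF x(1)] by simp
  moreover have "\<forall>\<^sub>F m in sequentially. N (compressed m x) =
      1 / real m * N (\<lambda>t. dilation (real m) (rearr x) t * indicator {0<..<1} t)"
    using eventually_gt_at_top[of 0]
    by eventually_elim (simp add: N_compressed[OF x(1)] dilated_head_def[abs_def])
  ultimately have "(\<lambda>m. 1 / real m * N (\<lambda>t. dilation (real m) (rearr x) t * indicator {0<..<1} t))
      \<longlonglongrightarrow> \<phi> x"
    by (rule Lim_transform_eventually)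
  then show ?thesis
    using \<phi>(1-3) by blast
qed

end
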